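(* Let $b>0$ and $\nu>1$. Let $f_{\overline{\Gamma}_\nu}(x,t)$, $x,t\ge0$, be the density of the fractional Gamma subordinator $\overline{\Gamma}_\nu(t)=\Gamma(\mathcal{A}_{1/\nu}(t))$, i.e. $f_{\overline{\Gamma}_\nu}(x,t)=\int_0^\infty f_\Gamma(x,z)\,h_{1/\nu}(z,t)\,dz$. Then, for $t>1$, $f_{\overline{\Gamma}_\nu}$ satisfies the equation $$\frac{\partial}{\partial x}f_{\overline{\Gamma}_\nu}=-b\,(1-\overline{\mathcal{O}}^{\nu}_{-1,t})f_{\overline{\Gamma}_\nu},\qquad x\ge0,$$ with initial condition $f_{\overline{\Gamma}_\nu}(0,t)=0$.
   Context: $\Gamma(t)$, $t\ge0$, is the Gamma subordinator with parameter $b>0$, with density $f_\Gamma(x,t)=\frac{b^t}{\Gamma(t)}x^{t-1}e^{-bx}$ for $x\ge0$ and $0$ for $x<0$ (in the formula $\Gamma(t)$ is Euler's Gamma function). For $\nu>1$, $\mathcal{A}_{1/\nu}$ is the stable subordinator of index $1/\nu$, with $\mathbb{E}e^{-k\mathcal{A}_{1/\nu}(t)}=e^{-k^{1/\nu}t}$, $k>0$, independent of $\Gamma$; $h_{1/\nu}(\cdot,t)$ is the density of $\mathcal{A}_{1/\nu}(t)$. The right-sided Riemann–Liouville derivative of order $\nu$, $m-1<\nu<m$, $m\in\mathbb{N}$, is $\mathcal{D}^\nu_{-,t}u(t)=\frac{1}{\Gamma(m-\nu)}\left(-\frac{d}{dt}\right)^m\int_t^{+\infty}\frac{u(s)}{(s-t)^{1+\nu-m}}\,ds$,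 $t>0$, and $\mathcal{D}^n_{-,t}=(-1)^n d^n/dt^n$ for $n\in\mathbb{N}$. For a continuous $f:\mathbb{R}^+\to\mathbb{R}$ having such fractional derivatives, and $c\in\mathbb{R}$, the fractional shift operator (for $\nu\ge1$) is $\overline{\mathcal{O}}^\nu_{c,t}f(t):=\sum_{n=0}^\infty\frac{(-c)^n}{n!}\underbrace{\mathcal{D}_{-,t}^\nu\cdots\mathcal{D}_{-,t}^\nu}_{n\text{ times}}f(t)$, provided the series converges; here it acts on the variable $t$ for fixed $x$.
   Formalization: The equation is proved for x>0 only: f(x,t) tends to +∞ as x→0+, so it fails at x=0. The initial condition f(0,t)=0 holds only as the value of the defining integral with 0^{z-1} read as 0 (also for z≤1), not as a limit x→0+. *)

theory Defs
  imports "HOL-Probability.Probability"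
begin

locale subordinator = prob_space M for M :: "'a measure" +
  fixes X :: "real \<Rightarrow> 'a \<Rightarrow> real"
  assumes rv [measurable]: "\<And>t. 0 \<le> t \<Longrightarrow> X t \<in> borel_measurable M"
    and start: "\<And>\<omega>. \<omega> \<in> space M \<Longrightarrow> X 0 \<omega> = 0"
    and mono_path: "\<And>\<omega>. \<omega> \<in> space M \<Longrightarrow> mono_on {0..} (\<lambda>t. X t \<omega>)"
    and right_cont_path:
      "\<And>\<omega> t. \<omega> \<in> space M \<Longrightarrow> 0 \<le> t \<Longrightarrow> continuous (at_right t) (\<lambda>s. X s \<omega>)"
    and indep_increments:
      "\<And>(\<tau> :: nat \<Rightarrow> real) n. 0 \<le> \<tau> 0 \<Longrightarrow> (\<And>i. i < n \<Longrightarrow> \<tau> i \<le> \<tau> (Suc i)) \<Longrightarrow>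
         indep_vars (\<lambda>_. borel) (\<lambda>i \<omega>. X (\<tau> (Suc i)) \<omega> - X (\<tau> i) \<omega>) {..<n}"
    and stationary_increments:
      "\<And>s t. 0 \<le> s \<Longrightarrow> 0 \<le> t \<Longrightarrow>
         distr M borel (\<lambda>\<omega>. X (s + t) \<omega> - X s \<omega>) = distr M borel (X t)"

text \<open>Since \<open>0 powr a = 0\<close> for every \<open>a\<close>, the value at \<open>x = 0\<close> is \<open>0\<close>,
  also for \<open>t \<le> 1\<close>, where the limit from the right is not \<open>0\<close>.\<close>
definition gamma_density :: "real \<Rightarrow> real \<Rightarrow> real \<Rightarrow> real" where
  "gamma_density b x t =
     (if x < 0 then 0 else b powr t / Gamma t * x powr (t - 1) * exp (- b * x))"

locale gamma_subordinator = subordinator +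
  fixes b :: real
  assumes gamma_marginal:
    "\<And>t. 0 < t \<Longrightarrow> distributed M lborel (X t) (\<lambda>x. ennreal (gamma_density b x t))"

locale stable_subordinator = subordinator +
  fixes \<alpha> :: real
  assumes laplace:
    "\<And>k t. 0 < k \<Longrightarrow> 0 \<le> t \<Longrightarrow> expectation (\<lambda>\<omega>. exp (- k * X t \<omega>)) = exp (- (k powr \<alpha>) * t)"

definition indep_processes ::
    "'a measure \<Rightarrow> (real \<Rightarrow> 'a \<Rightarrow> real) \<Rightarrow> (real \<Rightarrow> 'a \<Rightarrow> real) \<Rightarrow> bool" where
  "indep_processes M X Y \<longleftrightarrow>
     prob_space.indep_var M
       (PiM {0..} (\<lambda>_. borel)) (\<lambda>\<omega>. \<lambda>t\<in>{0..}. X t \<omega>)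
       (PiM {0..} (\<lambda>_. borel)) (\<lambda>\<omega>. \<lambda>t\<in>{0..}. Y t \<omega>)"

definition rl_kernel :: "real \<Rightarrow> nat \<Rightarrow> (real \<Rightarrow> real) \<Rightarrow> real \<Rightarrow> real \<Rightarrow> real" where
  "rl_kernel \<nu> m u t s = u s / (s - t) powr (1 + \<nu> - real m)"

definition rl_integral :: "real \<Rightarrow> nat \<Rightarrow> (real \<Rightarrow> real) \<Rightarrow> real \<Rightarrow> real" where
  "rl_integral \<nu> m u t = (LBINT s:{t<..}. rl_kernel \<nu> m u t s)"

text \<open>For non-integer \<open>\<nu> > 0\<close>, the \<open>m\<close> with \<open>m - 1 < \<nu> < m\<close> is \<open>nat \<lceil>\<nu>\<rceil>\<close>.
  The operator is total; its values are meaningful only under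
  \<open>rl_differentiable\<close> below.\<close>
definition rl_deriv :: "real \<Rightarrow> (real \<Rightarrow> real) \<Rightarrow> real \<Rightarrow> real" where
  "rl_deriv \<nu> u t =
     (if \<nu> \<in> \<nat> then (- 1) ^ nat \<lfloor>\<nu>\<rfloor> * (deriv ^^ nat \<lfloor>\<nu>\<rfloor>) u t
      else let m = nat \<lceil>\<nu>\<rceil> in
        1 / Gamma (real m - \<nu>) * ((- 1) ^ m * (deriv ^^ m) (rl_integral \<nu> m u) t))"

definition times_differentiable :: "nat \<Rightarrow> (real \<Rightarrow> real) \<Rightarrow> bool" where
  "times_differentiable m u \<longleftrightarrow> (\<forall>k<m. (deriv ^^ k) u differentiable_on {0<..})"

definition rl_differentiable :: "real \<Rightarrow> (real \<Rightarrow> real) \<Rightarrow> bool" where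
  "rl_differentiable \<nu> u \<longleftrightarrow>
     (if \<nu> \<in> \<nat> then times_differentiable (nat \<lfloor>\<nu>\<rfloor>) u
      else let m = nat \<lceil>\<nu>\<rceil> in
        (\<forall>t>0. set_integrable lborel {t<..} (rl_kernel \<nu> m u t)) \<and>
        times_differentiable m (rl_integral \<nu> m u))"

definition frac_shift_term :: "real \<Rightarrow> real \<Rightarrow> (real \<Rightarrow> real) \<Rightarrow> real \<Rightarrow> nat \<Rightarrow> real" where
  "frac_shift_term \<nu> c f t n = (- c) ^ n / fact n * (rl_deriv \<nu> ^^ n) f t"

definition frac_shift :: "real \<Rightarrow> real \<Rightarrow> (real \<Rightarrow> real) \<Rightarrow> real \<Rightarrow> real" where
  "frac_shift \<nu> c f t = (\<Sum>n. frac_shift_term \<nu> c f t n)"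

definition frac_shift_defined :: "real \<Rightarrow> real \<Rightarrow> (real \<Rightarrow> real) \<Rightarrow> real \<Rightarrow> bool" where
  "frac_shift_defined \<nu> c f t \<longleftrightarrow>
     continuous_on {0<..} f \<and>
     (\<forall>n. rl_differentiable \<nu> ((rl_deriv \<nu> ^^ n) f)) \<and>
     summable (frac_shift_term \<nu> c f t)"

end

theory Submission
  imports Defs "HOL-Complex_Analysis.Cauchy_Integral_Formula"
begin

text \<open>
  Write \<open>H\<^sub>g(t)\<close> for the integral of \<open>g(z) h(z,t)\<close> over \<open>z > 0\<close>, so that \<open>f(x,\<cdot>) = H\<^sub>g\<close> for
  \<open>g = f\<^sub>\<Gamma>(x,\<cdot>)\<close>. The Laplace transform of \<open>h\<close> turns \<open>g(z) = e\<^sup>-\<^sup>k\<^sup>z\<close> into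
  \<open>H\<^sub>g(t) = exp(- k\<^bsup>1/\<nu>\<^esup> t)\<close>, and the right-sided fractional derivative of order \<open>\<nu>\<close> multiplies this
  exponential by \<open>k\<close>. Hence on exponentials the fractional derivative of \<open>H\<^sub>g\<close> is \<open>H\<close> of \<open>-g'\<close>.

  The first half of the proof extends that identity from exponentials to smooth \<open>g\<close> such that \<open>e\<^sup>z g(z)\<close>
  and \<open>e\<^sup>z g'(z)\<close> tend to zero as \<open>z \<rightarrow> \<infinity>\<close>. By the Weierstrass theorem in the variable \<open>e\<^sup>-\<^sup>z\<close>, such a \<open>g\<close> lies within
  \<open>\<epsilon> e\<^sup>-\<^sup>z\<close> of a sum of terms \<open>a\<^sub>i e\<^bsup>-(i+1)z\<^esup>\<close> (\<open>exp_approxI\<close>). The weight \<open>e\<^sup>-\<^sup>z\<close> is preserved by every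
  operator in sight: \<open>|g(z)| \<le> \<epsilon> e\<^sup>-\<^sup>z\<close> implies \<open>|H\<^sub>g(t)| \<le> \<epsilon> e\<^sup>-\<^sup>t\<close>, because \<open>k = 1\<close> is
  mapped to \<open>k\<^bsup>1/\<nu>\<^esup> = 1\<close>; fractional integrals and tail integrals keep \<open>\<epsilon> e\<^sup>-\<^sup>t\<close> up to a constant; and so does
  passing from \<open>g'\<close> to \<open>g\<close>. Differentiation is not stable under such limits, so the approximation is done
  on an integrated identity (\<open>mix_antiderivative\<close>): with \<open>m - 1 < \<nu> < m\<close> the fractional integral of order
  \<open>m - \<nu>\<close> of \<open>H\<^sub>g\<close> is the \<open>m\<close>-fold tail integral of \<open>H\<close> of \<open>-g'\<close>. Differentiating \<open>m\<close> times gives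
  existence and value of the fractional derivative together (\<open>rl_deriv_mix\<close>).

  The second half is about the function \<open>z \<mapsto> f\<^sub>\<Gamma>(x,z)\<close>, which is entire since \<open>1/\<Gamma>\<close> is. The shift series
  for \<open>c = -1\<close> becomes \<open>H\<close> applied to the Taylor series of \<open>f\<^sub>\<Gamma>(x,\<cdot>)\<close> at \<open>z\<close>, evaluated at \<open>z - 1\<close>; hence it
  sums to \<open>H\<close> of \<open>f\<^sub>\<Gamma>(x,\<cdot>-1)\<close>, where for \<open>z < 1\<close> the entire continuation is meant. Cauchy's estimates on
  circles of radius \<open>2\<close> and the superexponential decay of \<open>1/\<Gamma>\<close> give the weighted bounds that make the series
  converge (\<open>gamma_kernel_time_derivatives\<close>, \<open>frac_shift_mix\<close>). Finally \<open>(z - 1) / \<Gamma>(z) = 1 / \<Gamma>(z - 1)\<close> says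
  that the derivative of \<open>f\<^sub>\<Gamma>(x,z)\<close> in \<open>x\<close> is \<open>b (f\<^sub>\<Gamma>(x,z-1) - f\<^sub>\<Gamma>(x,z))\<close>, and integrating this against
  \<open>h(z,t)\<close> is the asserted equation.
\<close>

section \<open>The Weyl integral on exponentially bounded functions\<close>

lemma has_bochner_integral_Gamma:
  fixes a :: real
  assumes "0 < a"
  shows "has_bochner_integral lborel (\<lambda>r. indicator {0..} r * r powr (a - 1) / exp r) (Gamma a)"
  using assms
  by (intro has_bochner_integral_nn_integral)
     (auto simp: Gamma_conv_nn_integral_real Gamma_real_pos less_imp_le)

text \<open>Every decaying exponential is an eigenfunction of the fractional integral; rescaling \<open>s - t\<close> reduces the
  eigenvalue to Euler's integral for \<open>\<Gamma>(m - \<nu>)\<close>.\<close>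

lemma rl_kernel_exp:
  fixes \<nu> \<mu> t :: real
  assumes "\<nu> < real m" and \<mu>: "0 < \<mu>"
  shows "set_integrable lborel {t<..} (rl_kernel \<nu> m (\<lambda>s. exp (- \<mu> * s)) t)"
    and "rl_integral \<nu> m (\<lambda>s. exp (- \<mu> * s)) t
           = Gamma (real m - \<nu>) * \<mu> powr (\<nu> - real m) * exp (- \<mu> * t)"
proof -
  define a where "a = real m - \<nu>"
  have a: "0 < a" using assms by (simp add: a_def)
  have "has_bochner_integral lborel
      (\<lambda>s. indicator {0..} (- \<mu> * t + \<mu> * s) * (- \<mu> * t + \<mu> * s) powr (a - 1)
              / exp (- \<mu> * t + \<mu> * s)) (Gamma a /\<^sub>R \<bar>\<mu>\<bar>)"
    using lborel_has_bochner_integral_real_affine_iff[of \<mu>, THEN iffD1,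
        OF _ has_bochner_integral_Gamma[OF a], of "- \<mu> * t"] \<mu> by simp
  then have 1: "has_bochner_integral lborel
      (\<lambda>s. (\<mu> powr (1 - a) * exp (- \<mu> * t)) * (indicator {0..} (- \<mu> * t + \<mu> * s)
            * (- \<mu> * t + \<mu> * s) powr (a - 1) / exp (- \<mu> * t + \<mu> * s)))
      ((\<mu> powr (1 - a) * exp (- \<mu> * t)) * (Gamma a /\<^sub>R \<bar>\<mu>\<bar>))"
    by (intro has_bochner_integral_mult_right)
  have 2: "(\<mu> powr (1 - a) * exp (- \<mu> * t)) * (indicator {0..} (- \<mu> * t + \<mu> * s)
            * (- \<mu> * t + \<mu> * s) powr (a - 1) / exp (- \<mu> * t + \<mu> * s))
      = indicator {t<..} s *\<^sub>R rl_kernel \<nu> m (\<lambda>s. exp (- \<mu> * s)) t s" for s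
  proof (cases "t < s")
    case True
    have eq: "- \<mu> * t + \<mu> * s = \<mu> * (s - t)" by (simp add: algebra_simps)
    have pos: "0 < \<mu> * (s - t)" using True \<mu> by simp
    have p1: "\<mu> powr (1 - a) * (\<mu> * (s - t)) powr (a - 1) = (s - t) powr (a - 1)"
      using True \<mu> by (simp add: powr_mult powr_add [symmetric] flip: mult.assoc)
    have p2: "(s - t) powr (a - 1) = 1 / (s - t) powr (1 + \<nu> - real m)"
      by (simp add: a_def powr_minus_divide [symmetric] algebra_simps)
    have e: "exp (- \<mu> * t) / exp (\<mu> * (s - t)) = exp (- \<mu> * s)"
      by (simp add: exp_diff [symmetric] algebra_simps)
    have "(\<mu> powr (1 - a) * exp (- \<mu> * t)) * (1 * (\<mu> * (s - t)) powr (a - 1) / exp (\<mu> * (s - t)))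
        = (\<mu> powr (1 - a) * (\<mu> * (s - t)) powr (a - 1)) * (exp (- \<mu> * t) / exp (\<mu> * (s - t)))"
      by (simp add: mult_ac)
    also have "\<dots> = exp (- \<mu> * s) / (s - t) powr (1 + \<nu> - real m)"
      by (simp only: p1 e p2) simp
    finally show ?thesis
      using True pos unfolding eq rl_kernel_def by simp
  next
    case False
    have "- \<mu> * t + \<mu> * s = \<mu> * (s - t)" by (simp add: algebra_simps)
    moreover have "\<mu> * (s - t) \<le> 0" using False \<mu> by (simp add: mult_le_0_iff)
    ultimately show ?thesis using False
      by (cases "s = t") (auto simp: indicator_def zero_le_mult_iff mult_le_0_iff)
  qed
  have 3: "(\<mu> powr (1 - a) * exp (- \<mu> * t)) * (Gamma a /\<^sub>R \<bar>\<mu>\<bar>)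
      = Gamma a * \<mu> powr (- a) * exp (- \<mu> * t)"
  proof -
    have "\<mu> powr (1 - a) = \<mu> * \<mu> powr (- a)"
      using \<mu> powr_add[of \<mu> 1 "- a"] by simp
    then show ?thesis using \<mu> by (simp add: field_simps)
  qed
  have *: "has_bochner_integral lborel
      (\<lambda>s. indicator {t<..} s *\<^sub>R rl_kernel \<nu> m (\<lambda>s. exp (- \<mu> * s)) t s)
      (Gamma a * \<mu> powr (- a) * exp (- \<mu> * t))"
    using 1 unfolding 2 3 .
  show "set_integrable lborel {t<..} (rl_kernel \<nu> m (\<lambda>s. exp (- \<mu> * s)) t)"
    unfolding set_integrable_def by (rule integrable.intros[OF *])
  have "(LBINT s:{t<..}. rl_kernel \<nu> m (\<lambda>s. exp (- \<mu> * s)) t s)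
      = Gamma a * \<mu> powr (- a) * exp (- \<mu> * t)"
    unfolding set_lebesgue_integral_def by (rule has_bochner_integral_integral_eq[OF *])
  then show "rl_integral \<nu> m (\<lambda>s. exp (- \<mu> * s)) t
           = Gamma (real m - \<nu>) * \<mu> powr (\<nu> - real m) * exp (- \<mu> * t)"
    by (simp add: rl_integral_def a_def)
qed

text \<open>The constant is a parameter because the limit arguments need to see it become small. The same predicate serves
  for functions of \<open>z\<close> and for functions of \<open>t\<close>.\<close>

definition exp_bounded :: "real \<Rightarrow> (real \<Rightarrow> real) \<Rightarrow> bool" where
  "exp_bounded C u \<longleftrightarrow> continuous_on {0<..} u \<and> (\<forall>t>0. \<bar>u t\<bar> \<le> C * exp (- t))"

lemma exp_boundedD:
  assumes "exp_bounded C u"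
  shows "continuous_on {0<..} u" "\<And>t. 0 < t \<Longrightarrow> \<bar>u t\<bar> \<le> C * exp (- t)"
  using assms by (auto simp: exp_bounded_def)

lemma exp_bounded_diff:
  assumes "exp_bounded C u" "exp_bounded D v"
  shows "exp_bounded (C + D) (\<lambda>t. u t - v t)"
  using assms unfolding exp_bounded_def
  by (auto intro!: continuous_intros simp: algebra_simps)
     (smt (verit, best))

text \<open>Since \<open>e\<^sup>-\<^sup>t\<close> has eigenvalue \<open>\<Gamma>(m - \<nu>)\<close>, comparison with it bounds the fractional integral in the same
  weighted supremum norm.\<close>

lemma rl_kernel_exp_bounded:
  assumes \<nu>: "\<nu> < real m" and u: "exp_bounded C u" and t: "0 < t"
  shows "set_integrable lborel {t<..} (rl_kernel \<nu> m u t)"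
    and "\<bar>rl_integral \<nu> m u t\<bar> \<le> Gamma (real m - \<nu>) * (C * exp (- t))"
proof -
  let ?E = "\<lambda>s. C * rl_kernel \<nu> m (\<lambda>s. exp (- 1 * s)) t s"
  have E: "set_integrable lborel {t<..} ?E"
    using rl_kernel_exp(1)[OF \<nu>, of 1 t] by (intro set_integrable_mult_right) simp
  have le: "\<bar>rl_kernel \<nu> m u t s\<bar> \<le> ?E s" if "t < s" for s
    using exp_boundedD(2)[OF u, of s] that t
    by (simp add: rl_kernel_def abs_mult divide_right_mono)
  have "continuous_on {t<..} (rl_kernel \<nu> m u t)"
    unfolding rl_kernel_def using t
    by (intro continuous_intros continuous_on_subset[OF exp_boundedD(1)[OF u]]) auto
  then have meas: "set_borel_measurable lborel {t<..} (rl_kernel \<nu> m u t)"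
    unfolding set_borel_measurable_def
    using borel_measurable_continuous_on_indicator[of "{t<..}" "rl_kernel \<nu> m u t"] by simp
  show int: "set_integrable lborel {t<..} (rl_kernel \<nu> m u t)"
    by (rule set_integrable_bound[OF E meas]) (use le in \<open>force intro!: AE_I2\<close>)
  have "\<bar>rl_integral \<nu> m u t\<bar> \<le> (LBINT s:{t<..}. \<bar>rl_kernel \<nu> m u t s\<bar>)"
    unfolding rl_integral_def using set_integral_norm_bound[OF int] by simp
  also have "\<dots> \<le> (LBINT s:{t<..}. ?E s)"
    by (rule set_integral_mono[OF set_integrable_abs[OF int] E]) (use le in auto)
  also have "\<dots> = Gamma (real m - \<nu>) * (C * exp (- t))"
    using rl_kernel_exp(2)[OF \<nu>, of 1 t] by (simp add: rl_integral_def)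
  finally show "\<bar>rl_integral \<nu> m u t\<bar> \<le> Gamma (real m - \<nu>) * (C * exp (- t))" .
qed

lemma rl_integral_diff:
  assumes "\<nu> < real m" "exp_bounded C u" "exp_bounded D v" "0 < t"
  shows "rl_integral \<nu> m (\<lambda>s. u s - v s) t = rl_integral \<nu> m u t - rl_integral \<nu> m v t"
  unfolding rl_integral_def
  using set_integral_diff(2)[OF rl_kernel_exp_bounded(1)[OF assms(1,2,4)]
      rl_kernel_exp_bounded(1)[OF assms(1,3,4)]]
  by (simp add: rl_kernel_def [abs_def] diff_divide_distrib)

lemma rl_integral_cong:
  assumes "\<And>s. t < s \<Longrightarrow> u s = v s"
  shows "rl_integral \<nu> m u t = rl_integral \<nu> m v t"
  unfolding rl_integral_def rl_kernel_def
  by (rule set_lebesgue_integral_cong) (use assms in auto)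

definition tail_integral :: "(real \<Rightarrow> real) \<Rightarrow> real \<Rightarrow> real" where
  "tail_integral u t = (LBINT s:{t<..}. u s)"

text \<open>The order-one case of the fractional integral, so that all estimates above apply to it.\<close>

lemma tail_integral_eq_rl_integral: "tail_integral = rl_integral 0 1"
  unfolding tail_integral_def rl_integral_def rl_kernel_def fun_eq_iff
  by (intro allI set_lebesgue_integral_cong) auto

lemma has_derivative_tail_integral:
  assumes u: "exp_bounded C u" and t: "0 < t"
  shows "(tail_integral u has_real_derivative - u t) (at t)"
proof -
  let ?c = "t / 2"
  have int: "set_integrable lborel {s<..} u" if "0 < s" for s
    using rl_kernel_exp_bounded(1)[OF _ u that, of 0 1]
    by (rule set_integrable_cong[THEN iffD1, rotated -1]) (auto simp: rl_kernel_def)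
  have cont: "continuous_on {?c..t+1} u"
    using t by (intro continuous_on_subset[OF exp_boundedD(1)[OF u]]) auto
  have split: "tail_integral u s = tail_integral u ?c - integral {?c..s} u"
    if s: "s \<in> {?c<..<t+1}" for s
  proof -
    have i: "set_integrable lborel {?c<..s} u"
      by (rule set_integrable_subset[OF int[of ?c]]) (use t in auto)
    have "{?c<..} = {?c<..s} \<union> {s<..}" using s by auto
    moreover have "{?c<..s} \<inter> {s<..} = {}" and "0 < s" using s t by auto
    ultimately have "(LBINT r:{?c<..}. u r) = (LBINT r:{?c<..s}. u r) + (LBINT r:{s<..}. u r)"
      by (simp only: set_integral_Un[OF _ i int])
    moreover have "(LBINT r:{?c<..s}. u r) = integral {?c<..s} u"
      by (rule set_borel_integral_eq_integral(2)[OF i])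
    moreover have "integral {?c<..s} u = integral {?c..s} u"
      by (rule integral_subset_negligible)
         (use s in \<open>auto intro: negligible_subset[of "{?c}"]\<close>)
    ultimately show ?thesis by (simp add: tail_integral_def)
  qed
  have "((\<lambda>s. integral {?c..s} u) has_real_derivative u t) (at t within {?c..t+1})"
    by (rule integral_has_real_derivative[OF cont]) (use t in auto)
  then have "((\<lambda>s. integral {?c..s} u) has_real_derivative u t) (at t)"
    using t by (simp add: at_within_Icc_at)
  then have "((\<lambda>s. tail_integral u ?c - integral {?c..s} u) has_real_derivative - u t) (at t)"
    by (auto intro!: derivative_eq_intros)
  then show ?thesis
    by (rule has_field_derivative_transform_within_open[of _ _ _ "{?c<..<t+1}"])
       (use t split in auto)
qed

lemma exp_bounded_tail_integral:
  assumes "exp_bounded C u"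
  shows "exp_bounded C (tail_integral u)"
proof -
  have "continuous_on {0<..} (tail_integral u)"
    using has_derivative_tail_integral[OF assms]
    by (intro continuous_at_imp_continuous_on) (auto intro: DERIV_isCont)
  then show ?thesis
    using rl_kernel_exp_bounded(2)[OF _ assms, of 0 1]
    by (auto simp: exp_bounded_def tail_integral_eq_rl_integral)
qed

lemma exp_bounded_tail_integral_funpow:
  "exp_bounded C u \<Longrightarrow> exp_bounded C ((tail_integral ^^ n) u)"
  by (induction n) (auto intro: exp_bounded_tail_integral)

text \<open>This concerns only \<open>t > 0\<close>: the function \<open>v\<close> may be arbitrary elsewhere, since derivatives at a positive
  point depend only on nearby values.\<close>

lemma higher_deriv_tail_integral:
  assumes u: "exp_bounded C u" and v: "\<And>t. 0 < t \<Longrightarrow> v t = (tail_integral ^^ m) u t"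
    and "k \<le> m" "0 < t"
  shows "(deriv ^^ k) v t = (- 1) ^ k * (tail_integral ^^ (m - k)) u t"
  using assms(3,4)
proof (induction k arbitrary: t)
  case 0
  then show ?case using v by simp
next
  case (Suc k)
  let ?w = "(tail_integral ^^ (m - Suc k)) u"
  have mk: "m - k = Suc (m - Suc k)" using Suc.prems by simp
  have "eventually (\<lambda>s. s \<in> {0<..}) (nhds t)"
    using Suc.prems by (intro eventually_nhds_in_open) auto
  then have "eventually (\<lambda>s. (deriv ^^ k) v s = (- 1) ^ k * tail_integral ?w s) (nhds t)"
    by eventually_elim (use Suc.IH Suc.prems mk in auto)
  then have "deriv ((deriv ^^ k) v) t = deriv (\<lambda>s. (- 1) ^ k * tail_integral ?w s) t"
    by (intro deriv_cong_ev refl)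
  also have "\<dots> = (- 1) ^ k * - ?w t"
    by (intro DERIV_imp_deriv DERIV_cmult Suc.prems(2)
        has_derivative_tail_integral[OF exp_bounded_tail_integral_funpow[OF u]])
  finally show ?case by simp
qed

lemma times_differentiable_tail_integral:
  assumes u: "exp_bounded C u" and v: "\<And>t. 0 < t \<Longrightarrow> v t = (tail_integral ^^ m) u t"
  shows "times_differentiable m v"
  unfolding times_differentiable_def
proof (intro allI impI)
  fix k assume k: "k < m"
  then have mk: "m - k = Suc (m - Suc k)" by simp
  let ?w = "(tail_integral ^^ (m - Suc k)) u"
  have "((\<lambda>s. (- 1) ^ k * tail_integral ?w s) has_real_derivative (- 1) ^ k * - ?w s) (at s)"
    if "0 < s" for s
    by (intro DERIV_cmult that
        has_derivative_tail_integral[OF exp_bounded_tail_integral_funpow[OF u]])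
  then have "((deriv ^^ k) v has_real_derivative (- 1) ^ k * - ?w s) (at s)" if "0 < s" for s
  proof (rule has_field_derivative_transform_within_open)
    show "(- 1) ^ k * tail_integral ?w r = (deriv ^^ k) v r" if "r \<in> {0<..}" for r
      using higher_deriv_tail_integral[OF u v, of k r] k mk that by simp
  qed (use that in auto)
  then show "(deriv ^^ k) v differentiable_on {0<..}"
    unfolding differentiable_on_def
    by (meson differentiable_at_withinI greaterThan_iff real_differentiable_def)
qed

section \<open>Exponential sums and weighted approximation\<close>

text \<open>The frequencies are a parameter since mixing replaces \<open>i + 1\<close> by \<open>(i + 1)\<^bsup>1/\<nu>\<^esup>\<close> and leaves the
  coefficients alone.\<close>

definition exp_sum :: "(nat \<Rightarrow> real) \<Rightarrow> nat \<Rightarrow> (nat \<Rightarrow> real) \<Rightarrow> real \<Rightarrow> real" where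
  "exp_sum a n \<mu> t = (\<Sum>i\<le>n. a i * exp (- \<mu> i * t))"

lemma exp_bounded_exp_sum:
  assumes "\<And>i. 1 \<le> \<mu> i"
  shows "exp_bounded (\<Sum>i\<le>n. \<bar>a i\<bar>) (exp_sum a n \<mu>)"
proof -
  have "\<bar>exp_sum a n \<mu> t\<bar> \<le> (\<Sum>i\<le>n. \<bar>a i\<bar>) * exp (- t)" if "0 < t" for t
  proof -
    have "\<bar>exp_sum a n \<mu> t\<bar> \<le> (\<Sum>i\<le>n. \<bar>a i * exp (- \<mu> i * t)\<bar>)"
      unfolding exp_sum_def by (rule sum_abs)
    also have "\<dots> \<le> (\<Sum>i\<le>n. \<bar>a i\<bar> * exp (- t))"
      using assms that by (intro sum_mono) (auto simp: abs_mult intro!: mult_left_mono)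
    finally show ?thesis by (simp add: sum_distrib_right)
  qed
  then show ?thesis
    unfolding exp_bounded_def by (auto simp: exp_sum_def intro!: continuous_intros)
qed

lemma rl_integral_exp_sum:
  assumes \<nu>: "\<nu> < real m" and \<mu>: "\<And>i. 0 < \<mu> i"
  shows "rl_integral \<nu> m (exp_sum a n \<mu>) t
           = Gamma (real m - \<nu>) * exp_sum (\<lambda>i. a i * \<mu> i powr (\<nu> - real m)) n \<mu> t"
proof -
  have "rl_integral \<nu> m (exp_sum a n \<mu>) t
      = (LBINT s:{t<..}. \<Sum>i\<le>n. a i * rl_kernel \<nu> m (\<lambda>s. exp (- \<mu> i * s)) t s)"
    by (simp add: rl_integral_def rl_kernel_def exp_sum_def sum_divide_distrib)
  also have "\<dots> = (\<Sum>i\<le>n. (LBINT s:{t<..}. a i * rl_kernel \<nu> m (\<lambda>s. exp (- \<mu> i * s)) t s))"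
    unfolding set_lebesgue_integral_def scaleR_sum_right
    using set_integrable_mult_right[OF rl_kernel_exp(1)[OF \<nu> \<mu>]]
    by (intro Bochner_Integration.integral_sum) (auto simp: set_integrable_def)
  also have "\<dots> = (\<Sum>i\<le>n. a i * rl_integral \<nu> m (\<lambda>s. exp (- \<mu> i * s)) t)"
    by (simp add: rl_integral_def)
  also have "\<dots> = Gamma (real m - \<nu>) * exp_sum (\<lambda>i. a i * \<mu> i powr (\<nu> - real m)) n \<mu> t"
    unfolding rl_kernel_exp(2)[OF \<nu> \<mu>] exp_sum_def sum_distrib_left
    by (simp only: mult_ac)
  finally show ?thesis .
qed

lemma tail_integral_funpow_exp_sum:
  assumes \<mu>: "\<And>i. 0 < \<mu> i"
  shows "(tail_integral ^^ k) (exp_sum a n \<mu>) = exp_sum (\<lambda>i. a i * \<mu> i powr (- real k)) n \<mu>"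
proof (induction k)
  case 0
  show ?case using \<mu> by (simp add: less_imp_neq[symmetric] fun_eq_iff)
next
  case (Suc k)
  have p: "\<mu> i powr (- real k) * \<mu> i powr (0 - real 1) = \<mu> i powr (- real (Suc k))" for i
    by (subst powr_add [symmetric]) (simp add: algebra_simps)
  have "Gamma (real 1 - 0) = (1 :: real)" by simp
  then have "tail_integral (exp_sum (\<lambda>i. a i * \<mu> i powr (- real k)) n \<mu>) t
      = exp_sum (\<lambda>i. a i * \<mu> i powr (- real (Suc k))) n \<mu> t" for t
    using rl_integral_exp_sum[of 0 1 \<mu> "\<lambda>i. a i * \<mu> i powr (- real k)" n t, OF _ \<mu>]
    unfolding tail_integral_eq_rl_integral mult.assoc p by simp
  then have "tail_integral (exp_sum (\<lambda>i. a i * \<mu> i powr (- real k)) n \<mu>)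
      = exp_sum (\<lambda>i. a i * \<mu> i powr (- real (Suc k))) n \<mu>"
    by (rule ext)
  then show ?case by (simp only: funpow.simps comp_def Suc.IH)
qed

lemma tail_integral_funpow_cmult:
  "(tail_integral ^^ k) (\<lambda>s. c * u s) = (\<lambda>s. c * (tail_integral ^^ k) u s)"
proof (induction k)
  case (Suc k)
  have "tail_integral (\<lambda>s. c * v s) = (\<lambda>s. c * tail_integral v s)" for v
    by (simp add: tail_integral_def fun_eq_iff)
  then show ?case by (simp only: funpow.simps comp_def Suc.IH)
qed simp

lemma tail_integral_funpow_diff:
  assumes "exp_bounded C u" "exp_bounded D v" "0 < t"
  shows "(tail_integral ^^ k) (\<lambda>s. u s - v s) t
           = (tail_integral ^^ k) u t - (tail_integral ^^ k) v t"
  using assms(3)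
proof (induction k arbitrary: t)
  case (Suc k)
  have "(tail_integral ^^ Suc k) (\<lambda>s. u s - v s) t
      = tail_integral (\<lambda>s. (tail_integral ^^ k) u s - (tail_integral ^^ k) v s) t"
    by (simp add: tail_integral_eq_rl_integral, rule rl_integral_cong)
       (use Suc in \<open>auto simp: tail_integral_eq_rl_integral\<close>)
  also have "\<dots> = (tail_integral ^^ Suc k) u t - (tail_integral ^^ Suc k) v t"
    using rl_integral_diff[of 0 1, OF _ exp_bounded_tail_integral_funpow[OF assms(1)]
        exp_bounded_tail_integral_funpow[OF assms(2)] Suc.prems]
    by (simp add: tail_integral_eq_rl_integral)
  finally show ?case .
qed simp

lemma eq_if_approx:
  fixes x y :: real
  assumes "\<And>e. 0 < e \<Longrightarrow> \<bar>x - y\<bar> \<le> K * e"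
  shows "x = y"
proof (rule ccontr)
  assume "x \<noteq> y"
  then have d: "0 < \<bar>x - y\<bar>" by simp
  let ?e = "\<bar>x - y\<bar> / (2 * (\<bar>K\<bar> + 1))"
  have e: "0 < ?e" using d by (intro divide_pos_pos) auto
  have "\<bar>x - y\<bar> \<le> K * ?e" using assms[OF e] .
  also have "\<dots> \<le> (\<bar>K\<bar> + 1) * ?e" using e by (intro mult_right_mono) auto
  also have "\<dots> = \<bar>x - y\<bar> / 2" by (simp add: field_simps)
  finally show False using d by simp
qed

text \<open>The frequencies start at \<open>1\<close>, not \<open>0\<close>, so that the approximants obey the weight \<open>e\<^sup>-\<^sup>z\<close>.\<close>

definition exp_approx :: "(real \<Rightarrow> real) \<Rightarrow> bool" where
  "exp_approx g \<longleftrightarrow>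
     (\<forall>e>0. \<exists>a n. exp_bounded e (\<lambda>z. g z - exp_sum a n (\<lambda>i. real (Suc i)) z))"

text \<open>With \<open>y = e\<^sup>-\<^sup>z\<close> the claim is that \<open>\<psi>(y) = g(- ln y) / y\<close> can be approximated uniformly by polynomials on
  \<open>[0,1]\<close>; the limit assumption makes \<open>\<psi>\<close> continuous at \<open>0\<close>.\<close>

lemma exp_approxI:
  fixes g :: "real \<Rightarrow> real"
  assumes cont: "continuous_on {0..} g" and lim: "((\<lambda>z. exp z * g z) \<longlongrightarrow> 0) at_top"
  shows "exp_approx g"
  unfolding exp_approx_def
proof (intro allI impI)
  fix e :: real assume e: "0 < e"
  define \<psi> where "\<psi> y = (if y = 0 then 0 else g (- ln y) / y)" for y :: real
  have "continuous (at y within {0..1}) \<psi>" if y: "y \<in> {0..1}" for y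
  proof (cases "y = 0")
    case True
    have "((\<lambda>y. exp (- ln y) * g (- ln y)) \<longlongrightarrow> 0) (at_right 0)"
      by (rule filterlim_compose[OF lim])
         (use ln_at_0 in \<open>simp add: filterlim_uminus_at_bot\<close>)
    moreover have "eventually (\<lambda>y. exp (- ln y) * g (- ln y) = \<psi> y) (at_right (0::real))"
      using eventually_at_right_less[of "0::real"]
      by eventually_elim (simp add: \<psi>_def exp_minus field_simps)
    ultimately have "(\<psi> \<longlongrightarrow> 0) (at_right 0)"
      by (rule Lim_transform_eventually)
    then have "(\<psi> \<longlongrightarrow> \<psi> 0) (at 0 within {0..1})"
      by (simp add: at_within_Icc_at_right \<psi>_def)
    then show ?thesis using True by (simp add: continuous_within)
  next
    case False
    have "continuous_on {0<..1} (\<lambda>y. g (- ln y) / y)"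
      by (intro continuous_intros continuous_on_compose2[OF cont]) auto
    then have "continuous (at y within {0<..1}) (\<lambda>y. g (- ln y) / y)"
      using y False by (auto simp: continuous_on_eq_continuous_within)
    then have "continuous (at y within {0<..1}) \<psi>"
      by (rule continuous_transform_within[of _ _ _ y]) (use y False in \<open>auto simp: \<psi>_def\<close>)
    moreover have "at y within {0<..1} = at y within {0..1}"
      by (rule at_within_nhd[of _ "{0<..}"]) (use y False in auto)
    ultimately show ?thesis by (simp add: continuous_within)
  qed
  then have "continuous_on {0..1} \<psi>"
    by (simp add: continuous_on_eq_continuous_within)
  from Stone_Weierstrass_real_polynomial_function[OF compact_Icc this e]
  obtain p where p: "real_polynomial_function p" "\<And>y. y \<in> {0..1} \<Longrightarrow> \<bar>\<psi> y - p y\<bar> < e"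
    by blast
  from p(1) obtain a n where an: "p = (\<lambda>x. \<Sum>i\<le>n. a i * x ^ i)"
    using real_polynomial_function_iff_sum by metis
  have bound: "\<bar>g z - exp_sum a n (\<lambda>i. real (Suc i)) z\<bar> \<le> e * exp (- z)" if z: "0 < z" for z
  proof -
    have "g z = exp (- z) * \<psi> (exp (- z))"
      by (simp add: \<psi>_def)
    moreover have "exp_sum a n (\<lambda>i. real (Suc i)) z = exp (- z) * p (exp (- z))"
      unfolding exp_sum_def an sum_distrib_left
      by (intro sum.cong refl)
         (simp add: exp_of_nat_mult [symmetric] exp_add [symmetric] algebra_simps)
    ultimately have "\<bar>g z - exp_sum a n (\<lambda>i. real (Suc i)) z\<bar>
        = exp (- z) * \<bar>\<psi> (exp (- z)) - p (exp (- z))\<bar>"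
      by (simp add: abs_mult flip: right_diff_distrib)
    also have "\<dots> \<le> exp (- z) * e"
      using p(2)[of "exp (- z)"] z by (intro mult_left_mono) (auto intro: less_imp_le)
    finally show ?thesis by (simp add: mult.commute)
  qed
  have "continuous_on {0<..} (\<lambda>z. g z - exp_sum a n (\<lambda>i. real (Suc i)) z)"
    unfolding exp_sum_def by (intro continuous_intros continuous_on_subset[OF cont]) auto
  then show "\<exists>a n. exp_bounded e (\<lambda>z. g z - exp_sum a n (\<lambda>i. real (Suc i)) z)"
    using bound by (auto simp: exp_bounded_def)
qed

text \<open>Approximating \<open>\<phi> = - g'\<close> approximates \<open>g\<close> with the same error, because \<open>e\<^sup>-\<^sup>z\<close> is minus its own derivative:
  both \<open>\<epsilon> e\<^sup>-\<^sup>z \<plusminus> (g - Q)\<close> are nonincreasing with limit \<open>0\<close>, hence nonnegative.\<close>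

lemma exp_bounded_antiderivative:
  assumes deriv: "\<And>z. 0 < z \<Longrightarrow> (g has_real_derivative - \<phi> z) (at z)"
    and lim: "(g \<longlongrightarrow> 0) at_top"
    and \<phi>: "exp_bounded e (\<lambda>z. \<phi> z - exp_sum a n (\<lambda>i. real (Suc i)) z)"
  shows "exp_bounded e (\<lambda>z. g z - exp_sum (\<lambda>i. a i / real (Suc i)) n (\<lambda>i. real (Suc i)) z)"
proof -
  let ?P = "exp_sum a n (\<lambda>i. real (Suc i))"
  let ?Q = "exp_sum (\<lambda>i. a i / real (Suc i)) n (\<lambda>i. real (Suc i))"
  have Q: "(?Q has_real_derivative - ?P z) (at z)" for z
    unfolding exp_sum_def [abs_def]
    by (auto intro!: derivative_eq_intros sum.cong simp: sum_negf [symmetric] simp del: of_nat_Suc)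
  have Qlim: "(?Q \<longlongrightarrow> 0) at_top"
    unfolding exp_sum_def [abs_def]
  proof (intro tendsto_null_sum tendsto_mult_right_zero)
    fix i
    have "filterlim (\<lambda>z. - real (Suc i) * z) at_bot at_top"
      by (rule filterlim_tendsto_neg_mult_at_bot[OF tendsto_const _ filterlim_ident]) simp
    then show "((\<lambda>z. exp (- real (Suc i) * z)) \<longlongrightarrow> 0) at_top"
      by (rule filterlim_compose[OF exp_at_bot])
  qed
  have elim: "((\<lambda>z. e * exp (- z)) \<longlongrightarrow> 0) at_top"
    by (intro tendsto_mult_right_zero filterlim_compose[OF exp_at_bot]
        filterlim_uminus_at_bot_at_top)
  have one: "0 \<le> e * exp (- z) + c * (g z - ?Q z)" if z: "0 < z" and c: "\<bar>c\<bar> = 1" for z c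
  proof -
    let ?D = "\<lambda>z. e * exp (- z) + c * (g z - ?Q z)"
    have D: "(?D has_real_derivative - e * exp (- y) + c * (- \<phi> y - - ?P y)) (at y)" if "0 < y" for y
      by (rule derivative_eq_intros deriv Q that refl | simp)+
    have neg: "- e * exp (- y) + c * (- \<phi> y - - ?P y) \<le> 0" if "0 < y" for y
    proof -
      have "c * (?P y - \<phi> y) \<le> \<bar>\<phi> y - ?P y\<bar>"
        using c by (cases "c \<ge> 0") (auto simp: abs_if split: if_splits)
      then show ?thesis using exp_boundedD(2)[OF \<phi> that] by simp
    qed
    have le: "?D y \<le> ?D z" if "z \<le> y" for y
    proof (rule DERIV_nonpos_imp_nonincreasing[OF that])
      fix x assume "z \<le> x"
      then have "0 < x" using z by simp
      then show "\<exists>y. (?D has_real_derivative y) (at x) \<and> y \<le> 0" using D neg by blast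
    qed
    have "(?D \<longlongrightarrow> 0 + c * (0 - 0)) at_top"
      by (intro tendsto_intros elim lim Qlim)
    then have "(?D \<longlongrightarrow> 0) at_top" by simp
    then show ?thesis
      by (rule tendsto_upperbound) (use le in \<open>auto intro: eventually_at_top_linorderI[of z]\<close>)
  qed
  have "\<bar>g z - ?Q z\<bar> \<le> e * exp (- z)" if "0 < z" for z
    using one[OF that, of 1] one[OF that, of "- 1"] by (simp add: abs_le_iff)
  moreover have "continuous_on {0<..} (\<lambda>z. g z - ?Q z)"
    using DERIV_isCont[OF deriv] DERIV_isCont[OF Q]
    by (intro continuous_intros continuous_at_imp_continuous_on) auto
  ultimately show ?thesis by (auto simp: exp_bounded_def)
qed

section \<open>Fractional derivatives of mixtures over a stable density\<close>

locale stable_density =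
  fixes \<nu> :: real and h :: "real \<Rightarrow> real \<Rightarrow> real"
  assumes nu: "1 < \<nu>"
    and nonneg: "\<And>z t. 0 < t \<Longrightarrow> 0 \<le> h z t"
    and measurable: "\<And>t. 0 < t \<Longrightarrow> (\<lambda>z. h z t) \<in> borel_measurable borel"
    and laplace: "\<And>k t. 1 \<le> k \<Longrightarrow> 0 < t \<Longrightarrow>
      has_bochner_integral lborel (\<lambda>z. indicator {0<..} z *\<^sub>R (exp (- k * z) * h z t))
        (exp (- (k powr (1 / \<nu>)) * t))"
begin

definition mix :: "(real \<Rightarrow> real) \<Rightarrow> real \<Rightarrow> real" where
  "mix g t = (LBINT z:{0<..}. g z * h z t)"

lemma laplace_set:
  assumes "1 \<le> k" "0 < t"
  shows "set_integrable lborel {0<..} (\<lambda>z. exp (- k * z) * h z t)"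
    and "mix (\<lambda>z. exp (- k * z)) t = exp (- (k powr (1 / \<nu>)) * t)"
  unfolding set_integrable_def mix_def set_lebesgue_integral_def
  using laplace[OF assms] by (auto intro: integrable.intros has_bochner_integral_integral_eq)

lemma mix_exp_bounded:
  assumes g: "exp_bounded C g" and t: "0 < t"
  shows "set_integrable lborel {0<..} (\<lambda>z. g z * h z t)"
    and "\<bar>mix g t\<bar> \<le> C * exp (- t)"
proof -
  let ?E = "\<lambda>z. C * (exp (- 1 * z) * h z t)"
  have E: "set_integrable lborel {0<..} ?E"
    by (intro set_integrable_mult_right laplace_set(1)) (use t in auto)
  have le: "\<bar>g z * h z t\<bar> \<le> ?E z" if "0 < z" for z
    using mult_right_mono[OF exp_boundedD(2)[OF g that] nonneg[OF t, of z]] nonneg[OF t, of z]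
    by (simp add: abs_mult mult_ac)
  have "(\<lambda>z. (indicator {0<..} z *\<^sub>R g z) * h z t) \<in> borel_measurable borel"
    using borel_measurable_continuous_on_indicator[OF _ exp_boundedD(1)[OF g]] measurable[OF t]
    by (intro borel_measurable_times) auto
  then have meas: "set_borel_measurable lborel {0<..} (\<lambda>z. g z * h z t)"
    by (simp add: set_borel_measurable_def mult.assoc)
  show int: "set_integrable lborel {0<..} (\<lambda>z. g z * h z t)"
    by (rule set_integrable_bound[OF E meas]) (use le in \<open>force intro!: AE_I2\<close>)
  have "\<bar>mix g t\<bar> \<le> (LBINT z:{0<..}. \<bar>g z * h z t\<bar>)"
    unfolding mix_def using set_integral_norm_bound[OF int] by simp
  also have "\<dots> \<le> (LBINT z:{0<..}. ?E z)"
    by (rule set_integral_mono[OF set_integrable_abs[OF int] E]) (use le in auto)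
  also have "\<dots> = C * exp (- t)"
    using laplace_set(2)[of 1 t] t by (simp add: mix_def)
  finally show "\<bar>mix g t\<bar> \<le> C * exp (- t)" .
qed

lemma mix_diff:
  assumes "exp_bounded C u" "exp_bounded D v" "0 < t"
  shows "mix (\<lambda>z. u z - v z) t = mix u t - mix v t"
  unfolding mix_def left_diff_distrib
  by (intro set_integral_diff(2) mix_exp_bounded(1)[OF assms(1,3)] mix_exp_bounded(1)[OF assms(2,3)])

lemma mix_sum:
  assumes "\<And>i. i \<in> I \<Longrightarrow> exp_bounded (C i) (u i)" "0 < t"
  shows "mix (\<lambda>z. \<Sum>i\<in>I. c i * u i z) t = (\<Sum>i\<in>I. c i * mix (u i) t)"
proof -
  have "mix (\<lambda>z. \<Sum>i\<in>I. c i * u i z) t = (LBINT z:{0<..}. \<Sum>i\<in>I. c i * (u i z * h z t))"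
    by (simp add: mix_def sum_distrib_right mult.assoc)
  also have "\<dots> = (\<Sum>i\<in>I. (LBINT z:{0<..}. c i * (u i z * h z t)))"
    unfolding set_lebesgue_integral_def scaleR_sum_right
    using set_integrable_mult_right[OF mix_exp_bounded(1)[OF assms]]
    by (intro Bochner_Integration.integral_sum) (auto simp: set_integrable_def)
  finally show ?thesis by (simp add: mix_def)
qed

lemma mix_exp_sum:
  assumes "0 < t"
  shows "mix (exp_sum a n (\<lambda>i. real (Suc i))) t
           = exp_sum a n (\<lambda>i. real (Suc i) powr (1 / \<nu>)) t"
proof -
  have b: "exp_bounded 1 (\<lambda>z. exp (- real (Suc i) * z))" for i
    by (auto simp: exp_bounded_def algebra_simps intro!: continuous_intros)
  have "mix (\<lambda>z. \<Sum>i\<le>n. a i * exp (- real (Suc i) * z)) t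
      = (\<Sum>i\<le>n. a i * mix (\<lambda>z. exp (- real (Suc i) * z)) t)"
    by (rule mix_sum[OF b assms])
  then show ?thesis
    unfolding exp_sum_def [abs_def] by (simp only: laplace_set(2)[OF _ assms] of_nat_Suc le_add_same_cancel1 of_nat_0_le_iff)
qed

text \<open>Continuity in \<open>t\<close> cannot be read off from the density; it comes from the explicit mixtures of exponential
  sums, of which every such mixture is a uniform limit.\<close>

lemma exp_bounded_mix:
  assumes g: "exp_bounded C g" and approx: "exp_approx g"
  shows "exp_bounded C (mix g)"
proof -
  have "\<forall>k. \<exists>a n. exp_bounded (1 / real (Suc k)) (\<lambda>z. g z - exp_sum a n (\<lambda>i. real (Suc i)) z)"
    using approx by (simp add: exp_approx_def)
  then obtain a n where an:
    "\<And>k. exp_bounded (1 / real (Suc k)) (\<lambda>z. g z - exp_sum (a k) (n k) (\<lambda>i. real (Suc i)) z)"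
    by metis
  let ?e = "\<lambda>k. exp_sum (a k) (n k) (\<lambda>i. real (Suc i) powr (1 / \<nu>))"
  have dist: "\<bar>mix g t - ?e k t\<bar> \<le> 1 / real (Suc k)" if "0 < t" for k t
  proof -
    have "\<bar>mix g t - ?e k t\<bar> \<le> 1 / real (Suc k) * exp (- t)"
      using mix_exp_bounded(2)[OF an that, of k]
        mix_diff[OF g exp_bounded_exp_sum that, of "\<lambda>i. real (Suc i)" "a k" "n k"]
        mix_exp_sum[OF that, of "a k" "n k"] by simp
    also have "\<dots> \<le> 1 / real (Suc k) * 1"
      using that by (intro mult_left_mono) auto
    finally show ?thesis by simp
  qed
  have "uniform_limit {0<..} ?e (mix g) sequentially"
  proof (rule uniform_limitI)
    fix e :: real assume "0 < e"
    then have "eventually (\<lambda>k. 1 / real (Suc k) < e) sequentially"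
      using LIMSEQ_inverse_real_of_nat order_tendstoD(2) by (fastforce simp: inverse_eq_divide)
    then show "\<forall>\<^sub>F k in sequentially. \<forall>t\<in>{0<..}. dist (?e k t) (mix g t) < e"
    proof eventually_elim
      case (elim k)
      show ?case
      proof
        fix t :: real assume "t \<in> {0<..}"
        then have "\<bar>mix g t - ?e k t\<bar> < e" using dist[of t k] elim by simp
        then show "dist (?e k t) (mix g t) < e" by (simp add: dist_real_def abs_minus_commute)
      qed
    qed
  qed
  then have "continuous_on {0<..} (mix g)"
    by (rule uniform_limit_theorem[rotated])
       (auto simp: exp_sum_def intro!: continuous_intros always_eventually)
  then show ?thesis using mix_exp_bounded(2)[OF g] by (auto simp: exp_bounded_def)
qed

text \<open>Both sides are continuous in \<open>g\<close> for the weighted norm, so it suffices to compare them on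
  \<open>g = e\<^sup>-\<^sup>k\<^sup>z / k\<close>, \<open>\<phi> = e\<^sup>-\<^sup>k\<^sup>z\<close>. With \<open>\<mu> = k\<^bsup>1/\<nu>\<^esup>\<close> both equal \<open>\<Gamma>(m - \<nu>) \<mu>\<^sup>-\<^sup>m e\<^bsup>-\<mu>t\<^esup>\<close>, because
  \<open>\<mu>\<^bsup>\<nu>-m\<^esup> / k = \<mu>\<^sup>-\<^sup>m\<close>. For an integer \<open>\<nu> = m\<close> the fractional integral disappears.\<close>

lemma mix_antiderivative:
  assumes deriv: "\<And>z. 0 < z \<Longrightarrow> (g has_real_derivative - \<phi> z) (at z)"
    and lim: "(g \<longlongrightarrow> 0) at_top"
    and \<phi>: "exp_bounded C \<phi>" "exp_approx \<phi>"
    and g: "exp_bounded D g" "exp_approx g"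
    and t: "0 < t"
  shows "\<nu> < real m \<Longrightarrow> rl_integral \<nu> m (mix g) t
           = Gamma (real m - \<nu>) * (tail_integral ^^ m) (mix \<phi>) t" (is "_ \<Longrightarrow> ?frac")
    and "\<nu> = real m \<Longrightarrow> mix g t = (tail_integral ^^ m) (mix \<phi>) t" (is "_ \<Longrightarrow> ?int")
proof -
  let ?S = "\<lambda>i. real (Suc i)" and ?L = "\<lambda>i. real (Suc i) powr (1 / \<nu>)"
  have L: "1 \<le> ?L i" for i using nu by (intro ge_one_powr_ge_zero) auto
  then have L0: "0 < ?L i" for i by (meson less_le_trans zero_less_one)
  note bounded = exp_bounded_exp_sum[OF L]
  have boundedS: "exp_bounded (\<Sum>i\<le>n. \<bar>a i\<bar>) (exp_sum a n ?S)" for a n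
    by (rule exp_bounded_exp_sum) simp
  \<comment> \<open>Mixing turns the frequencies \<open>i + 1\<close> into \<open>(i + 1)\<^bsup>1/\<nu>\<^esup>\<close> and does not enlarge the error.\<close>
  have near: "exp_bounded e (\<lambda>t. mix u t - exp_sum a n ?L t)"
    if u: "exp_bounded e (\<lambda>z. u z - exp_sum a n ?S z)" "exp_bounded B u" "exp_approx u" for u e a n B
  proof -
    have "\<bar>mix u t - exp_sum a n ?L t\<bar> \<le> e * exp (- t)" if "0 < t" for t
      using mix_exp_bounded(2)[OF u(1) that] mix_diff[OF u(2) boundedS that] mix_exp_sum[OF that]
      by simp
    then show ?thesis
      using exp_boundedD(1)[OF exp_bounded_diff[OF exp_bounded_mix[OF u(2,3)] bounded]]
      by (auto simp: exp_bounded_def)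
  qed
  have key: "\<exists>a n. exp_bounded e (\<lambda>t. mix \<phi> t - exp_sum a n ?L t) \<and>
      exp_bounded e (\<lambda>t. mix g t - exp_sum (\<lambda>i. a i / ?S i) n ?L t)" if "0 < e" for e
    using \<phi>(2) that near[OF _ \<phi>] near[OF exp_bounded_antiderivative[OF deriv lim] g]
    unfolding exp_approx_def by meson
  have tail: "\<bar>(tail_integral ^^ m) (mix \<phi>) t - exp_sum (\<lambda>i. a i * ?L i powr (- real m)) n ?L t\<bar>
      \<le> e * exp (- t)" if e: "exp_bounded e (\<lambda>t. mix \<phi> t - exp_sum a n ?L t)" for a n e
    using exp_boundedD(2)[OF exp_bounded_tail_integral_funpow[OF e, of m] t]
      tail_integral_funpow_diff[OF exp_bounded_mix[OF \<phi>] bounded t, of m a n]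
    by (simp only: tail_integral_funpow_exp_sum[OF L0])
  have Lnu: "?L i powr \<nu> = ?S i" for i
    using nu by (simp add: powr_powr)
  {
    assume m: "\<nu> < real m"
    let ?G = "Gamma (real m - \<nu>)"
    have G: "0 < ?G" using m by (intro Gamma_real_pos) simp
    show ?frac
    proof (rule eq_if_approx)
      fix e :: real assume "0 < e"
      from key[OF this] obtain a n where
        1: "exp_bounded e (\<lambda>t. mix \<phi> t - exp_sum a n ?L t)" and
        2: "exp_bounded e (\<lambda>t. mix g t - exp_sum (\<lambda>i. a i / ?S i) n ?L t)" by blast
      let ?X = "exp_sum (\<lambda>i. a i * ?L i powr (- real m)) n ?L t"
      have "a i / ?S i * ?L i powr (\<nu> - real m) = a i * ?L i powr (- real m)" for i
        using powr_add[of "?L i" \<nu> "- real m"] unfolding Lnu by (simp add: algebra_simps del: of_nat_Suc)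
      then have "rl_integral \<nu> m (exp_sum (\<lambda>i. a i / ?S i) n ?L) t = ?G * ?X"
        unfolding rl_integral_exp_sum[OF m L0] by (simp only:)
      then have "\<bar>rl_integral \<nu> m (mix g) t - ?G * ?X\<bar> \<le> ?G * (e * exp (- t))"
        using rl_kernel_exp_bounded(2)[OF m 2 t]
          rl_integral_diff[OF m exp_bounded_mix[OF g] bounded t]
        by (simp only:)
      moreover have "\<bar>?G * (tail_integral ^^ m) (mix \<phi>) t - ?G * ?X\<bar> \<le> ?G * (e * exp (- t))"
        using mult_left_mono[OF tail[OF 1], of ?G] G
        by (simp add: abs_mult flip: right_diff_distrib)
      ultimately show "\<bar>rl_integral \<nu> m (mix g) t - ?G * (tail_integral ^^ m) (mix \<phi>) t\<bar>
          \<le> (2 * ?G * exp (- t)) * e" by (simp add: algebra_simps)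
    qed
  next
    assume m: "\<nu> = real m"
    show ?int
    proof (rule eq_if_approx)
      fix e :: real assume "0 < e"
      from key[OF this] obtain a n where
        1: "exp_bounded e (\<lambda>t. mix \<phi> t - exp_sum a n ?L t)" and
        2: "exp_bounded e (\<lambda>t. mix g t - exp_sum (\<lambda>i. a i / ?S i) n ?L t)" by blast
      have "a i * ?L i powr (- real m) = a i / ?S i" for i
        using Lnu[of i] m by (simp add: powr_minus_divide del: of_nat_Suc)
      with tail[OF 1] exp_boundedD(2)[OF 2 t]
      show "\<bar>mix g t - (tail_integral ^^ m) (mix \<phi>) t\<bar> \<le> (2 * exp (- t)) * e"
        by (simp add: algebra_simps)
    qed
  }
qed

text \<open>Fractional differentiation of a mixture is differentiation of the mixed function: the \<open>m\<close> derivatives in the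
  definition undo the \<open>m\<close> tail integrals above. Since \<open>u\<close> is prescribed for positive times only, the lemma can
  be iterated.\<close>

lemma rl_deriv_mix:
  assumes deriv: "\<And>z. 0 < z \<Longrightarrow> (g has_real_derivative - \<phi> z) (at z)"
    and lim: "(g \<longlongrightarrow> 0) at_top"
    and \<phi>: "exp_bounded C \<phi>" "exp_approx \<phi>"
    and g: "exp_bounded D g" "exp_approx g"
    and u: "\<And>t. 0 < t \<Longrightarrow> u t = mix g t"
  shows "rl_differentiable \<nu> u" and "\<And>t. 0 < t \<Longrightarrow> rl_deriv \<nu> u t = mix \<phi> t"
proof -
  have *: "rl_differentiable \<nu> u \<and> (\<forall>t>0. rl_deriv \<nu> u t = mix \<phi> t)"
  proof (cases "\<nu> \<in> \<nat>")
    case True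
    then obtain m where m: "\<nu> = real m" by (auto elim: Nats_cases)
    note ub = exp_bounded_mix[OF \<phi>]
    have v: "u t = (tail_integral ^^ m) (mix \<phi>) t" if "0 < t" for t
      using mix_antiderivative(2)[OF deriv lim \<phi> g that m] u[OF that] by simp
    show ?thesis
      using times_differentiable_tail_integral[OF ub v] higher_deriv_tail_integral[OF ub v, of m]
      by (simp add: rl_differentiable_def rl_deriv_def m flip: mult.assoc power_add)
  next
    case False
    define m where "m = nat \<lceil>\<nu>\<rceil>"
    have "\<nu> \<noteq> real m" using False by auto
    then have m: "\<nu> < real m" unfolding m_def using nu by linarith
    let ?G = "Gamma (real m - \<nu>)"
    have "0 < ?G" using m by (intro Gamma_real_pos) simp
    then have G: "?G \<noteq> 0" by linarith
    obtain B where ub: "exp_bounded B (\<lambda>t. ?G * mix \<phi> t)"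
    proof
      show "exp_bounded (\<bar>?G\<bar> * C) (\<lambda>t. ?G * mix \<phi> t)"
        using exp_bounded_mix[OF \<phi>] unfolding exp_bounded_def
        by (auto intro!: continuous_intros mult_left_mono simp: abs_mult mult.assoc)
    qed
    have v: "rl_integral \<nu> m u t = (tail_integral ^^ m) (\<lambda>t. ?G * mix \<phi> t) t" if "0 < t" for t
      using mix_antiderivative(1)[OF deriv lim \<phi> g that m] rl_integral_cong[of t u "mix g"] u that
      by (simp add: tail_integral_funpow_cmult)
    have "set_integrable lborel {t<..} (rl_kernel \<nu> m u t)" if "0 < t" for t
      using rl_kernel_exp_bounded(1)[OF m exp_bounded_mix[OF g] that]
      by (rule set_integrable_cong[THEN iffD1, rotated -1]) (use u that in \<open>auto simp: rl_kernel_def\<close>)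
    then show ?thesis
      using times_differentiable_tail_integral[OF ub v] higher_deriv_tail_integral[OF ub v, of m] False G
      by (simp add: rl_differentiable_def rl_deriv_def Let_def flip: m_def)
  qed
  from * show "rl_differentiable \<nu> u" by blast
  from * show "\<And>t. 0 < t \<Longrightarrow> rl_deriv \<nu> u t = mix \<phi> t" by blast
qed

text \<open>Here \<open>g n\<close> stands for \<open>(-d/dz)\<^sup>n\<close> of \<open>g 0\<close>. The \<open>n\<close>-th term of the shift series is the mixture of
  \<open>g n / n!\<close>, whose weighted norm is at most \<open>C / 2\<^sup>n\<close>; so summation and mixing commute, by a geometric tail
  bound. The exponent \<open>- 2 z\<close> gives room for \<open>e\<^sup>z g(z)\<close> to vanish at infinity.\<close>

theorem frac_shift_mix:
  assumes deriv: "\<And>n z. 0 < z \<Longrightarrow> (g n has_real_derivative - g (Suc n) z) (at z)"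
    and cont: "\<And>n. continuous_on {0..} (g n)"
    and bound: "\<And>n z. 0 \<le> z \<Longrightarrow> \<bar>g n z\<bar> \<le> C * fact n / 2 ^ n * exp (- 2 * z)"
    and sums: "\<And>z. 0 < z \<Longrightarrow> (\<lambda>n. g n z / fact n) sums G z"
    and G: "continuous_on {0<..} G"
    and u: "\<And>t. 0 < t \<Longrightarrow> u t = mix (g 0) t"
    and t: "0 < t"
  shows "frac_shift_defined \<nu> (- 1) u t" and "frac_shift \<nu> (- 1) u t = mix G t"
proof -
  have C: "0 \<le> C"
    using bound[of 0 0] by simp
  have gc: "continuous_on {0<..} (g n)" for n
    by (rule continuous_on_subset[OF cont]) auto
  have gb: "exp_bounded (C * fact n / 2 ^ n) (g n)" for n
  proof -
    have "\<bar>g n z\<bar> \<le> C * fact n / 2 ^ n * exp (- z)" if "0 < z" for z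
    proof -
      have "exp (- 2 * z) \<le> exp (- z)" using that by simp
      then show ?thesis using C that by (intro order_trans[OF bound] mult_left_mono) simp_all
    qed
    then show ?thesis
      using gc by (auto simp: exp_bounded_def)
  qed
  have e0: "((\<lambda>z::real. exp (- z)) \<longlongrightarrow> 0) at_top"
    by (intro filterlim_compose[OF exp_at_bot] filterlim_uminus_at_bot_at_top)
  have lim1: "((\<lambda>z. exp z * g n z) \<longlongrightarrow> 0) at_top" for n
  proof (rule Lim_null_comparison)
    show "((\<lambda>z::real. C * fact n / 2 ^ n * exp (- z)) \<longlongrightarrow> 0) at_top"
      by (intro tendsto_mult_right_zero e0)
    have "\<bar>exp z * g n z\<bar> \<le> C * fact n / 2 ^ n * exp (- z)" if "0 \<le> z" for z
    proof -
      have "exp z * \<bar>g n z\<bar> \<le> exp z * (C * fact n / 2 ^ n * exp (- 2 * z))"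
        by (intro mult_left_mono bound that) auto
      also have "\<dots> = C * fact n / 2 ^ n * (exp z * exp (- 2 * z))" by (simp only: mult_ac)
      also have "exp z * exp (- 2 * z) = exp (- z)" by (subst exp_add [symmetric]) simp
      finally show ?thesis by (simp add: abs_mult)
    qed
    then show "\<forall>\<^sub>F z in at_top. norm (exp z * g n z) \<le> C * fact n / 2 ^ n * exp (- z)"
      unfolding real_norm_def by (rule eventually_at_top_linorderI)
  qed
  have ga: "exp_approx (g n)" for n
    by (rule exp_approxI[OF cont lim1])
  have lim: "(g n \<longlongrightarrow> 0) at_top" for n
  proof -
    have eq: "exp z * g n z * exp (- z) = g n z" for z
      by (simp add: exp_minus field_simps)
    show ?thesis using tendsto_mult[OF lim1[of n] e0] by (simp only: eq mult_zero_left)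
  qed
  have step: "rl_differentiable \<nu> v \<and> (\<forall>t>0. rl_deriv \<nu> v t = mix (g (Suc n)) t)"
    if v: "\<And>t. 0 < t \<Longrightarrow> v t = mix (g n) t" for v n
  proof (intro conjI allI impI)
    show "rl_differentiable \<nu> v"
      by (rule rl_deriv_mix(1)[where g = "g n" and \<phi> = "g (Suc n)", OF _ lim gb ga gb ga v])
         (rule deriv)
    show "rl_deriv \<nu> v t = mix (g (Suc n)) t" if "0 < t" for t
      by (rule rl_deriv_mix(2)[where g = "g n" and \<phi> = "g (Suc n)", OF _ lim gb ga gb ga v that])
         (rule deriv)
  qed
  have iter: "0 < s \<Longrightarrow> (rl_deriv \<nu> ^^ n) u s = mix (g n) s" for n s
  proof (induction n arbitrary: s)
    case (Suc n)
    show ?case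
      using step[OF Suc.IH] Suc.prems by simp
  qed (use u in simp)
  have diff: "rl_differentiable \<nu> ((rl_deriv \<nu> ^^ n) u)" for n
    using step[OF iter] by blast
  \<comment> \<open>The remainder of the series is at most the geometric tail \<open>\<Sum>\<^bsub>n \<ge> N\<^esub> C / 2\<^sup>n\<close>.\<close>
  have Gtail: "exp_bounded (2 * C / 2 ^ N) (\<lambda>z. G z - (\<Sum>n<N. 1 / fact n * g n z))" for N
  proof -
    have "\<bar>G z - (\<Sum>n<N. 1 / fact n * g n z)\<bar> \<le> 2 * C / 2 ^ N * exp (- z)" if z: "0 < z" for z
    proof -
      have s: "(\<lambda>n. g (n + N) z / fact (n + N)) sums (G z - (\<Sum>n<N. g n z / fact n))"
        using sums_split_initial_segment[OF sums[OF z]] by simp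
      have m: "(\<lambda>n. C / 2 ^ N * exp (- z) * (1 / 2) ^ n) sums (C / 2 ^ N * exp (- z) * 2)"
        using geometric_sums[of "1 / 2 :: real"] by (intro sums_mult) simp
      have le: "\<bar>g (n + N) z / fact (n + N)\<bar> \<le> C / 2 ^ N * exp (- z) * (1 / 2) ^ n" for n
      proof -
        have "\<bar>g (n + N) z\<bar> \<le> fact (n + N) * (C / 2 ^ N * exp (- z) * (1 / 2) ^ n)"
          using exp_boundedD(2)[OF gb z, of "n + N"] by (simp add: power_add power_divide mult_ac)
        then show ?thesis by (simp add: abs_mult divide_le_eq mult.commute)
      qed
      have "norm (\<Sum>n. g (n + N) z / fact (n + N)) \<le> (\<Sum>n. C / 2 ^ N * exp (- z) * (1 / 2) ^ n)"
        by (rule norm_suminf_le) (use le sums_summable[OF m] in auto)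
      then have "\<bar>G z - (\<Sum>n<N. g n z / fact n)\<bar> \<le> C / 2 ^ N * exp (- z) * 2"
        unfolding sums_unique[OF s, symmetric] sums_unique[OF m, symmetric] real_norm_def .
      then show ?thesis by (simp add: mult_ac)
    qed
    moreover have "continuous_on {0<..} (\<lambda>z. G z - (\<Sum>n<N. 1 / fact n * g n z))"
      by (intro continuous_intros G gc)
    ultimately show ?thesis unfolding exp_bounded_def by blast
  qed
  have Gb: "exp_bounded (2 * C) G" using Gtail[of 0] by simp
  have Sb: "exp_bounded (2 * C + 2 * C / 2 ^ N) (\<lambda>z. \<Sum>n<N. 1 / fact n * g n z)" for N
    using exp_bounded_diff[OF Gb Gtail[of N]] by simp
  have terms: "frac_shift_term \<nu> (- 1) u t = (\<lambda>n. 1 / fact n * mix (g n) t)"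
    using iter[OF t] by (simp add: frac_shift_term_def fun_eq_iff)
  have "(\<lambda>n. 1 / fact n * mix (g n) t) sums mix G t"
    unfolding sums_def
  proof (rule LIM_zero_cancel, rule Lim_null_comparison)
    have "norm ((\<Sum>n<N. 1 / fact n * mix (g n) t) - mix G t) \<le> 2 * C * exp (- t) * (1 / 2) ^ N" for N
    proof -
      have "\<bar>mix G t - (\<Sum>n<N. 1 / fact n * mix (g n) t)\<bar> \<le> 2 * C / 2 ^ N * exp (- t)"
        using mix_exp_bounded(2)[OF Gtail t, of N] mix_diff[OF Gb Sb t, of N]
          mix_sum[where u = g and I = "{..<N}" and c = "\<lambda>n. 1 / fact n", OF gb t]
        by (simp only:)
      then show ?thesis
        by (simp add: abs_minus_commute power_divide mult_ac)
    qed
    then show "\<forall>\<^sub>F N in sequentially. norm ((\<Sum>n<N. 1 / fact n * mix (g n) t) - mix G t)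
        \<le> 2 * C * exp (- t) * (1 / 2) ^ N"
      by (intro always_eventually allI)
    show "(\<lambda>N. 2 * C * exp (- t) * (1 / 2) ^ N) \<longlonglongrightarrow> 0"
      by (intro tendsto_mult_right_zero LIMSEQ_power_zero) simp
  qed
  then have s: "frac_shift_term \<nu> (- 1) u t sums mix G t" by (simp only: terms)
  then show "frac_shift \<nu> (- 1) u t = mix G t"
    unfolding frac_shift_def by (rule sums_unique[symmetric])
  have "continuous_on {0<..} u"
    using exp_boundedD(1)[OF exp_bounded_mix[OF gb ga]] by (rule continuous_on_eq) (simp add: u)
  then show "frac_shift_defined \<nu> (- 1) u t"
    using diff sums_summable[OF s] by (simp add: frac_shift_defined_def)
qed

end

section \<open>The Gamma kernel as an entire function of the time variable\<close>

text \<open>In a horizontal strip \<open>1/\<Gamma>\<close> decays faster than any exponential: stepping right by one divides it by a factor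
  of modulus at least \<open>c\<close> as soon as the real part exceeds \<open>c + 1\<close>, and a compact rectangle remains to the left.\<close>

lemma rGamma_strip_bound:
  fixes c :: real
  assumes c: "1 \<le> c"
  obtains M where "0 \<le> M"
    "\<And>w. \<bar>Im w\<bar> \<le> 2 \<Longrightarrow> - 2 \<le> Re w \<Longrightarrow> norm (rGamma w) * c powr Re w \<le> M"
proof -
  \<comment> \<open>From real part \<open>c + 1\<close> on, \<open>|w - 1| \<ge> c\<close>.\<close>
  define N where "N = c + 1"
  have "continuous_on (cbox (Complex (- 2) (- 2)) (Complex N 2)) (rGamma :: complex \<Rightarrow> complex)"
    by (intro holomorphic_on_imp_continuous_on holomorphic_rGamma)
  then have "bounded (rGamma ` cbox (Complex (- 2) (- 2)) (Complex N 2))"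
    by (intro compact_imp_bounded compact_continuous_image compact_cbox)
  then obtain B where "\<forall>y \<in> rGamma ` cbox (Complex (- 2) (- 2)) (Complex N 2). norm y \<le> B"
    unfolding bounded_iff by blast
  then have B: "norm (rGamma w) \<le> B" if "\<bar>Im w\<bar> \<le> 2" "- 2 \<le> Re w" "Re w \<le> N" for w
    using that by (auto simp: in_cbox_complex_iff abs_le_iff)
  have "norm (rGamma w) * c powr Re w \<le> B * c powr N"
    if "\<bar>Im w\<bar> \<le> 2" "- 2 \<le> Re w" "Re w \<le> N + real n" for n w
    using that
  proof (induction n arbitrary: w)
    case 0
    then show ?case using c B[of w]
      by (intro mult_mono B powr_mono) (auto intro: order_trans[OF norm_ge_zero])
  next
    case (Suc n)
    show ?case
    proof (cases "Re w \<le> N + real n")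
      case True
      then show ?thesis using Suc by blast
    next
      case False
      then have big: "c < Re (w - 1)" unfolding N_def by simp
      then have le: "c \<le> norm (w - 1)"
        using complex_Re_le_cmod[of "w - 1"] by linarith
      have "(w - 1) * rGamma w = rGamma (w - 1)"
        using rGamma_plus1[of "w - 1"] by simp
      then have "norm (w - 1) * norm (rGamma w) = norm (rGamma (w - 1))"
        by (metis norm_mult)
      then have "c * norm (rGamma w) \<le> norm (rGamma (w - 1))"
        using mult_right_mono[OF le norm_ge_zero[of "rGamma w"]] by simp
      moreover have "c powr Re w = c * c powr Re (w - 1)"
        using powr_add[of c 1 "Re (w - 1)"] c by simp
      ultimately have "norm (rGamma w) * c powr Re w \<le> norm (rGamma (w - 1)) * c powr Re (w - 1)"
        using mult_right_mono[of "c * norm (rGamma w)" _ "c powr Re (w - 1)"]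
        by (simp add: mult_ac)
      also have "\<dots> \<le> B * c powr N"
        using Suc.prems big c by (intro Suc.IH) auto
      finally show ?thesis .
    qed
  qed
  moreover have "\<exists>n. Re w \<le> N + real n" for w
    using real_arch_simple[of "Re w - N"] by (auto simp: algebra_simps)
  ultimately have "norm (rGamma w) * c powr Re w \<le> B * c powr N"
    if "\<bar>Im w\<bar> \<le> 2" "- 2 \<le> Re w" for w
    using that by metis
  moreover have "0 \<le> B * c powr N"
    using B[of 0] c unfolding N_def by simp
  ultimately show thesis using that by blast
qed

text \<open>The Gamma density with \<open>1/\<Gamma>\<close> read as an entire function, hence meaningful also for \<open>z \<le> 0\<close>; this matters for
  the values at \<open>z - 1\<close> and \<open>z - 2\<close>.\<close>

definition gamma_kernel :: "real \<Rightarrow> real \<Rightarrow> real \<Rightarrow> real" where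
  "gamma_kernel b x z = b * exp (- b * x) * (b * x) powr (z - 1) * rGamma z"

definition cgamma_kernel :: "real \<Rightarrow> real \<Rightarrow> complex \<Rightarrow> complex" where
  "cgamma_kernel b x w = of_real (b * exp (- b * x)) * of_real (b * x) powr (w - 1) * rGamma w"

lemma cgamma_kernel_of_real:
  assumes "0 < b" "0 < x"
  shows "cgamma_kernel b x (of_real z) = of_real (gamma_kernel b x z)"
proof -
  have "complex_of_real (b * x) powr (of_real z - 1) = of_real ((b * x) powr (z - 1))"
    using assms powr_of_real[of "b * x" "z - 1"] by simp
  then show ?thesis
    unfolding cgamma_kernel_def gamma_kernel_def by (simp add: rGamma_complex_of_real)
qed

lemma holomorphic_cgamma_kernel:
  assumes "0 < b" "0 < x"
  shows "cgamma_kernel b x holomorphic_on S"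
  using assms unfolding cgamma_kernel_def [abs_def]
  by (auto intro!: holomorphic_intros)

lemma gamma_density_eq_gamma_kernel:
  assumes "0 < b" "0 < x"
  shows "gamma_density b x z = gamma_kernel b x z"
proof -
  have "b powr z = b * b powr (z - 1)"
    using powr_add[of b 1 "z - 1"] assms by simp
  then show ?thesis using assms
    by (simp add: gamma_density_def gamma_kernel_def powr_mult rGamma_inverse_Gamma field_simps)
qed

text \<open>Uniformity in \<open>x\<close> is needed for the Taylor remainder in \<open>x\<close>; radius \<open>2\<close> covers both the Cauchy circles and
  the shifts of \<open>z\<close> by one and two.\<close>

lemma cgamma_kernel_bound:
  assumes b: "0 < b" and x1: "0 < x1"
  obtains C where "0 \<le> C"
    "\<And>x z w. x1 \<le> x \<Longrightarrow> x \<le> x2 \<Longrightarrow> 0 \<le> z \<Longrightarrow> norm (w - of_real z) \<le> 2 \<Longrightarrow>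
       norm (cgamma_kernel b x w) \<le> C * exp (- 2 * z)"
proof -
  \<comment> \<open>The factor \<open>e\<^sup>2\<close> in \<open>c\<close> is what leaves \<open>e\<^bsup>-2z\<^esup>\<close> after bounding \<open>(b x)\<^bsup>Re w\<^esup>\<close> by a power of \<open>d\<close>.\<close>
  define d where "d = max 1 (b * x2)"
  define c where "c = d * exp 2"
  have d: "1 \<le> d" "b * x2 \<le> d" by (auto simp: d_def)
  have c: "1 \<le> c" unfolding c_def using d(1) mult_mono[of 1 d 1 "exp 2 :: real"] by simp
  obtain M where M: "0 \<le> M"
    "\<And>w. \<bar>Im w\<bar> \<le> 2 \<Longrightarrow> - 2 \<le> Re w \<Longrightarrow> norm (rGamma w) * c powr Re w \<le> M"
    using rGamma_strip_bound[OF c] by blast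
  let ?C = "b * (b * x1) powr (- 3) * c powr 2 * M"
  show thesis
  proof
    show "0 \<le> ?C" using M(1) b by simp
    fix x z :: real and w :: complex
    assume x: "x1 \<le> x" "x \<le> x2" and z: "0 \<le> z" and w: "norm (w - of_real z) \<le> 2"
    have bx: "0 < b * x1" "b * x1 \<le> b * x" "b * x \<le> d"
      using b x1 x(1) order_trans[OF mult_left_mono[OF x(2), of b] d(2)] by auto
    have Im: "\<bar>Im w\<bar> \<le> 2" using abs_Im_le_cmod[of "w - of_real z"] w by simp
    have Re: "z - 2 \<le> Re w" using abs_Re_le_cmod[of "w - of_real z"] w by simp
    \<comment> \<open>The exponent \<open>Re w - 1\<close> can be as low as \<open>- 3\<close>; splitting this off leaves an exponent that is nonnegative.\<close>
    have "(b * x) powr (Re w - 1) = (b * x) powr (- 3) * (b * x) powr (Re w + 2)"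
      by (simp add: powr_add [symmetric])
    also have "\<dots> \<le> (b * x1) powr (- 3) * d powr (Re w + 2)"
    proof (rule mult_mono)
      show "(b * x) powr (- 3) \<le> (b * x1) powr (- 3)" using bx by (intro powr_mono2') auto
      show "(b * x) powr (Re w + 2) \<le> d powr (Re w + 2)" using bx Re z by (intro powr_mono2) auto
    qed auto
    also have "d powr (Re w + 2) = c powr (Re w + 2) * exp (- 2 * (Re w + 2))"
    proof -
      have "exp 2 powr (Re w + 2) * exp (- 2 * (Re w + 2)) = 1"
        by (simp add: powr_def exp_add [symmetric] algebra_simps)
      then show ?thesis using d by (simp add: c_def powr_mult mult.assoc)
    qed
    also have "\<dots> \<le> c powr (Re w + 2) * exp (- 2 * z)"
      using Re by (intro mult_left_mono) auto
    also have "c powr (Re w + 2) = c powr 2 * c powr Re w"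
      by (simp add: powr_add mult.commute)
    finally have p: "(b * x) powr (Re w - 1)
        \<le> (b * x1) powr (- 3) * (c powr 2 * c powr Re w * exp (- 2 * z))"
      by (simp add: mult_left_mono)
    have "norm (of_real (b * x) powr (w - 1)) = (b * x) powr (Re w - 1)"
      using bx by (subst norm_powr_real_powr) auto
    then have "norm (cgamma_kernel b x w) = b * exp (- b * x) * (b * x) powr (Re w - 1) * norm (rGamma w)"
      unfolding cgamma_kernel_def norm_mult norm_of_real using b by simp
    also have "\<dots> \<le> b * 1 * ((b * x1) powr (- 3) * (c powr 2 * c powr Re w * exp (- 2 * z))) * norm (rGamma w)"
      using p b bx(1) order_trans[OF less_imp_le[OF bx(1)] bx(2)]
      by (intro mult_mono mult_nonneg_nonneg) simp_all
    also have "\<dots> = b * (b * x1) powr (- 3) * c powr 2 * exp (- 2 * z) * (norm (rGamma w) * c powr Re w)"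
      by (simp only: mult_ac mult_1_left)
    also have "\<dots> \<le> b * (b * x1) powr (- 3) * c powr 2 * exp (- 2 * z) * M"
      using M(2)[OF Im] Re z b by (intro mult_left_mono) auto
    finally show "norm (cgamma_kernel b x w) \<le> ?C * exp (- 2 * z)"
      by (simp only: mult_ac)
  qed
qed

text \<open>Cauchy's inequality on the circle of radius \<open>2\<close> beats the shift length \<open>1\<close>, so the Taylor series at \<open>z\<close>
  converges at \<open>z - 1\<close> geometrically with ratio \<open>1/2\<close>, uniformly in the weight.\<close>

lemma gamma_kernel_time_derivatives:
  fixes b x :: real
  assumes b: "0 < b" and x: "0 < x"
  obtains g C where
    "\<And>n z. (g n has_real_derivative - g (Suc n) z) (at z)"
    "\<And>n z. 0 \<le> z \<Longrightarrow> \<bar>g n z\<bar> \<le> C * fact n / 2 ^ n * exp (- 2 * z)"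
    "\<And>z. (\<lambda>n. g n z / fact n) sums gamma_kernel b x (z - 1)"
    "g 0 = gamma_kernel b x"
proof -
  let ?G = "cgamma_kernel b x"
  note hol = holomorphic_cgamma_kernel[OF b x]
  obtain C where "0 \<le> C" and bound: "\<And>y z w. x \<le> y \<Longrightarrow> y \<le> x \<Longrightarrow> 0 \<le> z \<Longrightarrow>
      norm (w - of_real z) \<le> 2 \<Longrightarrow> norm (cgamma_kernel b y w) \<le> C * exp (- 2 * z)"
    using cgamma_kernel_bound[OF b x, of x] by blast
  note C = bound[OF order_refl order_refl]
  define g where "g n z = (- 1) ^ n * Re ((deriv ^^ n) ?G (of_real z))" for n z
  show thesis
  proof
    show "(g n has_real_derivative - g (Suc n) z) (at z)" for n z
    proof -
      have "((deriv ^^ n) ?G has_field_derivative (deriv ^^ Suc n) ?G (of_real z)) (at (of_real z))"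
        using holomorphic_derivI[OF holomorphic_higher_deriv[OF hol, of UNIV n] open_UNIV, of "of_real z"]
        by simp
      then have "((\<lambda>z. Re ((deriv ^^ n) ?G (of_real z))) has_real_derivative
          Re ((deriv ^^ Suc n) ?G (of_real z))) (at z)"
        unfolding has_real_derivative_iff_has_vector_derivative
        by (intro bounded_linear.has_vector_derivative[OF bounded_linear_Re]
            has_vector_derivative_real_field)
      from DERIV_cmult[OF this, of "(- 1) ^ n"] show ?thesis
        unfolding g_def [abs_def] by simp
    qed
    show "\<bar>g n z\<bar> \<le> C * fact n / 2 ^ n * exp (- 2 * z)" if z: "0 \<le> z" for n z
    proof -
      have "norm ((deriv ^^ n) ?G (of_real z)) \<le> fact n * (C * exp (- 2 * z)) / 2 ^ n"
        by (intro Cauchy_inequality hol holomorphic_on_imp_continuous_on C z)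
           (auto simp: norm_minus_commute)
      then show ?thesis
        using abs_Re_le_cmod[of "(deriv ^^ n) ?G (of_real z)"]
        by (simp add: g_def abs_mult mult_ac)
    qed
    show "(\<lambda>n. g n z / fact n) sums gamma_kernel b x (z - 1)" for z
    proof -
      have "(\<lambda>n. (deriv ^^ n) ?G (of_real z) / fact n * (of_real (z - 1) - of_real z) ^ n)
          sums ?G (of_real (z - 1))"
        by (rule holomorphic_power_series[where r = 2]) (auto simp: dist_norm intro: hol)
      from sums_Re[OF this] have "(\<lambda>n. Re ((deriv ^^ n) ?G (of_real z) / fact n * (of_real (z - 1) - of_real z) ^ n))
          sums gamma_kernel b x (z - 1)"
        unfolding cgamma_kernel_of_real[OF b x] Re_complex_of_real .
      moreover have "Re ((deriv ^^ n) ?G (of_real z) / fact n * (of_real (z - 1) - of_real z) ^ n)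
          = g n z / fact n" for n
      proof -
        have "(of_real (z - 1) - of_real z) ^ n / fact n = complex_of_real ((- 1) ^ n / fact n)"
          by simp
        then have "(deriv ^^ n) ?G (of_real z) / fact n * (of_real (z - 1) - of_real z) ^ n
            = of_real ((- 1) ^ n / fact n) * (deriv ^^ n) ?G (of_real z)"
          by (metis (no_types) mult.commute times_divide_eq_left times_divide_eq_right)
        then show ?thesis 
          by (simp only: times_complex.sel Re_complex_of_real Im_complex_of_real g_def) simp
      qed
      ultimately show ?thesis by simp
    qed
    show "g 0 = gamma_kernel b x"
      using cgamma_kernel_of_real[OF b x] by (simp add: g_def fun_eq_iff)
  qed
qed

text \<open>The factor \<open>z - 1\<close> produced by the power of \<open>x\<close> is absorbed by \<open>(z - 1) / \<Gamma>(z) = 1 / \<Gamma>(z - 1)\<close>.\<close>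

lemma has_derivative_gamma_kernel:
  assumes b: "0 < b" and x: "0 < x"
  shows "((\<lambda>x. gamma_kernel b x z) has_real_derivative
           b * (gamma_kernel b x (z - 1) - gamma_kernel b x z)) (at x)"
proof -
  have "(z - 1) * rGamma z = rGamma (z - 1)"
    using rGamma_plus1[of "z - 1"] by simp
  then have r: "rGamma (z - 1) = (z - 1) * rGamma z" by simp
  have "((\<lambda>x. b * x) has_real_derivative b) (at x)"
    by (auto intro!: derivative_eq_intros)
  from DERIV_fun_powr[OF this, of "z - 1"]
  have 1: "((\<lambda>x. (b * x) powr (z - 1)) has_real_derivative
      (z - 1) * (b * x) powr (z - 1 - 1) * b) (at x)"
    using b x by simp
  have 2: "((\<lambda>x. b * exp (- b * x)) has_real_derivative b * (exp (- b * x) * - b)) (at x)"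
    by (auto intro!: derivative_eq_intros)
  have "((\<lambda>x. gamma_kernel b x z) has_real_derivative
      (b * (exp (- b * x) * - b) * (b * x) powr (z - 1)
        + (z - 1) * (b * x) powr (z - 1 - 1) * b * (b * exp (- b * x))) * rGamma z) (at x)"
    unfolding gamma_kernel_def by (intro DERIV_cmult_right DERIV_mult 1 2)
  then show ?thesis
    unfolding gamma_kernel_def r by (simp add: algebra_simps)
qed

text \<open>Each derivative in \<open>x\<close> only shifts \<open>z\<close>, so the second one is a combination of the kernel at \<open>z\<close>, \<open>z - 1\<close>
  and \<open>z - 2\<close> and inherits their bound.\<close>

lemma gamma_kernel_taylor:
  assumes b: "0 < b" and x: "0 < x"
  obtains C where
    "\<And>y z. x / 2 \<le> y \<Longrightarrow> y \<le> 2 * x \<Longrightarrow> 0 \<le> z \<Longrightarrow>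
       \<bar>gamma_kernel b y z - gamma_kernel b x z
          - (y - x) * (b * (gamma_kernel b x (z - 1) - gamma_kernel b x z))\<bar>
         \<le> C * (y - x)\<^sup>2 * exp (- z)"
    "\<And>y z. x / 2 \<le> y \<Longrightarrow> y \<le> 2 * x \<Longrightarrow> 0 \<le> z \<Longrightarrow> \<bar>gamma_kernel b y z\<bar> \<le> C * exp (- z)"
    "\<And>z. 0 \<le> z \<Longrightarrow> \<bar>gamma_kernel b x (z - 1)\<bar> \<le> C * exp (- z)"
proof -
  have "0 < x / 2" using x by simp
  then obtain C where C: "0 \<le> C"
    "\<And>y z w. x / 2 \<le> y \<Longrightarrow> y \<le> 2 * x \<Longrightarrow> 0 \<le> z \<Longrightarrow> norm (w - of_real z) \<le> 2 \<Longrightarrow>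
       norm (cgamma_kernel b y w) \<le> C * exp (- 2 * z)"
    using cgamma_kernel_bound[OF b, of "x / 2" "2 * x"] by blast
  have bnd: "\<bar>gamma_kernel b y w\<bar> \<le> C * exp (- z)"
    if y: "x / 2 \<le> y" "y \<le> 2 * x" and z: "0 \<le> z" and w: "\<bar>w - z\<bar> \<le> 2" for y z w
  proof -
    have "norm (cgamma_kernel b y (of_real w)) \<le> C * exp (- 2 * z)"
      using C(2)[OF y z, of "of_real w"] w by (simp flip: of_real_diff)
    also have "\<dots> \<le> C * exp (- z)" using C(1) z by (intro mult_left_mono) auto
    finally show ?thesis using cgamma_kernel_of_real[OF b, of y w] x y by simp
  qed
  define D where "D = max C (4 * b\<^sup>2 * C)"
  have D: "C * exp (- z) \<le> D * exp (- z)" "4 * b\<^sup>2 * C * exp (- z) \<le> D * exp (- z)" for z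
    by (auto simp: D_def)
  show thesis
  proof
    fix y z assume y: "x / 2 \<le> y" "y \<le> 2 * x" and z: "0 \<le> (z :: real)"
    show "\<bar>gamma_kernel b y z\<bar> \<le> D * exp (- z)"
      using order_trans[OF bnd[OF y z, of z] D(1)[of z]] by simp
    let ?k = "\<lambda>j y. gamma_kernel b y (z - j)"
    define F where "F i y = (if i = 0 then ?k 0 y else if i = 1 then b * (?k 1 y - ?k 0 y)
      else b * (b * (?k 2 y - ?k 1 y) - b * (?k 1 y - ?k 0 y)))" for i :: nat and y
    have "norm (F 0 y - (\<Sum>i\<le>1. F i x * (y - x) ^ i / fact i))
        \<le> (4 * b\<^sup>2 * C * exp (- z)) * norm (y - x) ^ Suc 1 / fact 1"
    proof (rule field_Taylor)
      show "convex {x / 2..2 * x}" by simp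
      show "x \<in> {x / 2..2 * x}" "y \<in> {x / 2..2 * x}" using x y by auto
      fix r assume r: "r \<in> {x / 2..2 * x}"
      then have r0: "0 < r" using x by simp
      have der: "(?k j has_real_derivative b * (?k (j + 1) r - ?k j r)) (at r within S)" for j S
        using has_derivative_gamma_kernel[OF b r0, of "z - j"]
        by (simp add: algebra_simps has_field_derivative_at_within)
      show "(F i has_real_derivative F (Suc i) r) (at r within {x / 2..2 * x})" if i: "i \<le> 1" for i
      proof (cases "i = 0")
        case True
        then show ?thesis using der[of 0] by (simp add: F_def [abs_def])
      next
        case False
        then have "i = 1" using i by simp
        then show ?thesis using DERIV_cmult[OF DERIV_diff[OF der[of 1] der[of 0]], of b]
          by (simp add: F_def [abs_def])
      qed
      have k: "\<bar>?k j r\<bar> \<le> C * exp (- z)" if "0 \<le> j" "j \<le> 2" for j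
        using bnd[of r z "z - j"] r z that by auto
      have "F (Suc 1) r = b\<^sup>2 * (?k 2 r - 2 * ?k 1 r + ?k 0 r)"
        by (simp add: F_def power2_eq_square algebra_simps)
      moreover have "\<bar>?k 2 r - 2 * ?k 1 r + ?k 0 r\<bar> \<le> 4 * (C * exp (- z))"
        using k[of 0] k[of 1] k[of 2] by linarith
      then have "b\<^sup>2 * \<bar>?k 2 r - 2 * ?k 1 r + ?k 0 r\<bar> \<le> b\<^sup>2 * (4 * (C * exp (- z)))"
        by (rule mult_left_mono) simp
      ultimately show "norm (F (Suc 1) r) \<le> 4 * b\<^sup>2 * C * exp (- z)"
        by (simp add: abs_mult mult_ac)
    qed
    also have "\<dots> = (4 * b\<^sup>2 * C * exp (- z)) * (y - x)\<^sup>2"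
      by (simp add: power2_eq_square)
    also have "\<dots> \<le> (D * exp (- z)) * (y - x)\<^sup>2"
      by (intro mult_right_mono D) auto
    finally show "\<bar>gamma_kernel b y z - gamma_kernel b x z
          - (y - x) * (b * (gamma_kernel b x (z - 1) - gamma_kernel b x z))\<bar>
         \<le> D * (y - x)\<^sup>2 * exp (- z)"
      by (simp add: F_def mult_ac diff_diff_eq)
  next
    fix z assume z: "0 \<le> (z :: real)"
    show "\<bar>gamma_kernel b x (z - 1)\<bar> \<le> D * exp (- z)"
      using order_trans[OF bnd[of x z "z - 1"] D(1)[of z]] x z by simp
  qed
qed

lemma continuous_gamma_kernel:
  assumes "0 < b" "0 < x"
  shows "continuous_on S (\<lambda>z. gamma_kernel b x (z - a))"
  unfolding gamma_kernel_def using assms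
  by (intro continuous_intros continuous_on_compose2[OF continuous_on_rGamma]) auto

lemma has_real_derivative_quadratic:
  fixes F :: "real \<Rightarrow> real"
  assumes d: "0 < d" and le: "\<And>y. \<bar>y - x\<bar> \<le> d \<Longrightarrow> \<bar>F y - F x - (y - x) * D\<bar> \<le> K * (y - x)\<^sup>2"
  shows "(F has_real_derivative D) (at x)"
  unfolding has_field_derivative_iff
proof (rule LIM_zero_cancel, rule Lim_null_comparison)
  show "((\<lambda>y. K * \<bar>y - x\<bar>) \<longlongrightarrow> 0) (at x)"
    by (auto intro!: tendsto_eq_intros)
  have "eventually (\<lambda>y. y \<in> ball x d - {x}) (at x)"
    using d by (intro eventually_at_in_open) auto
  then show "\<forall>\<^sub>F y in at x. norm ((F y - F x) / (y - x) - D) \<le> K * \<bar>y - x\<bar>"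
  proof eventually_elim
    case (elim y)
    then have "\<bar>F y - F x - (y - x) * D\<bar> \<le> K * (y - x)\<^sup>2"
      by (intro le) (auto simp: dist_real_def)
    moreover have "(F y - F x) / (y - x) - D = (F y - F x - (y - x) * D) / (y - x)"
      using elim by (simp add: diff_divide_distrib)
    moreover have "(y - x)\<^sup>2 = \<bar>y - x\<bar> * \<bar>y - x\<bar>"
      by (simp add: power2_eq_square flip: abs_mult)
    ultimately show ?case
      using elim by (simp add: divide_le_eq mult.assoc)
  qed
qed

context stable_density begin

lemma mix_cmult: "mix (\<lambda>z. c * u z) t = c * mix u t"
  by (simp add: mix_def mult.assoc)

text \<open>The remainder of the first-order expansion in \<open>x\<close> is quadratic in the weighted norm, hence remains quadratic
  after mixing; this replaces differentiation under the integral sign.\<close>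

lemma has_derivative_mix_gamma_kernel:
  assumes b: "0 < b" and x: "0 < x" and t: "0 < t"
  shows "((\<lambda>y. mix (gamma_kernel b y) t) has_real_derivative
           b * (mix (\<lambda>z. gamma_kernel b x (z - 1)) t - mix (gamma_kernel b x) t)) (at x)"
proof -
  obtain C where
    C: "\<And>y z. x / 2 \<le> y \<Longrightarrow> y \<le> 2 * x \<Longrightarrow> 0 \<le> z \<Longrightarrow>
       \<bar>gamma_kernel b y z - gamma_kernel b x z
          - (y - x) * (b * (gamma_kernel b x (z - 1) - gamma_kernel b x z))\<bar>
         \<le> C * (y - x)\<^sup>2 * exp (- z)"
    "\<And>y z. x / 2 \<le> y \<Longrightarrow> y \<le> 2 * x \<Longrightarrow> 0 \<le> z \<Longrightarrow> \<bar>gamma_kernel b y z\<bar> \<le> C * exp (- z)"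
    "\<And>z. 0 \<le> z \<Longrightarrow> \<bar>gamma_kernel b x (z - 1)\<bar> \<le> C * exp (- z)"
    using gamma_kernel_taylor[OF b x] by blast
  let ?k = "gamma_kernel b" and ?s = "\<lambda>z. gamma_kernel b x (z - 1)"
  have cont: "continuous_on S (?k y)" if "0 < y" for y S
    using continuous_gamma_kernel[OF b that, of S 0] by simp
  have k: "exp_bounded C (?k y)" if "x / 2 \<le> y" "y \<le> 2 * x" for y
    unfolding exp_bounded_def using that C(2) x by (intro conjI cont allI impI) auto
  have s: "exp_bounded C ?s"
    unfolding exp_bounded_def using C(3)
    by (intro conjI continuous_gamma_kernel[OF b x] allI impI) auto
  let ?d = "\<lambda>y z. ((y - x) * b) * (?s z - ?k x z)"
  show ?thesis
  proof (rule has_real_derivative_quadratic[of "x / 2"])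
    show "0 < x / 2" using x by simp
    fix y assume "\<bar>y - x\<bar> \<le> x / 2"
    then have y: "x / 2 \<le> y" "y \<le> 2 * x" by linarith+
    have kx: "exp_bounded C (?k x)" using x by (intro k) auto
    have dB: "exp_bounded (\<bar>(y - x) * b\<bar> * (C + C)) (?d y)"
      using exp_bounded_diff[OF s kx] unfolding exp_bounded_def
      by (auto intro!: continuous_intros mult_left_mono simp: abs_mult mult.assoc)
    have "continuous_on {0<..} (\<lambda>z. ?k y z - ?k x z - ?d y z)"
      using exp_boundedD(1)[OF k[OF y]] exp_boundedD(1)[OF kx] exp_boundedD(1)[OF dB]
      by (intro continuous_on_diff)
    then have "exp_bounded (C * (y - x)\<^sup>2) (\<lambda>z. ?k y z - ?k x z - ?d y z)"
      using C(1)[OF y] unfolding exp_bounded_def by (simp add: mult.assoc)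
    then have "\<bar>mix (\<lambda>z. ?k y z - ?k x z - ?d y z) t\<bar> \<le> C * (y - x)\<^sup>2 * exp (- t)"
      using mix_exp_bounded(2) t by blast
    also have "mix (\<lambda>z. ?k y z - ?k x z - ?d y z) t
        = mix (?k y) t - mix (?k x) t - (y - x) * (b * (mix ?s t - mix (?k x) t))"
      using mix_diff[OF exp_bounded_diff[OF k[OF y] kx] dB t] mix_diff[OF k[OF y] kx t]
        mix_diff[OF s kx t]
      by (simp add: mix_cmult mult.assoc)
    finally show "\<bar>mix (?k y) t - mix (?k x) t - (y - x) * (b * (mix ?s t - mix (?k x) t))\<bar>
        \<le> (C * exp (- t)) * (y - x)\<^sup>2" by (simp add: mult_ac)
  qed
qed

end

section \<open>The fractional Gamma subordinator\<close>

text \<open>Paths start at \<open>0\<close> and increase, so the density vanishes almost everywhere on the negative axis, and the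
  Laplace transform is an integral over \<open>z > 0\<close>.\<close>

lemma stable_density_of_subordinator:
  assumes nu: "1 < \<nu>" and A: "stable_subordinator M A (1 / \<nu>)"
    and nonneg: "\<And>z t. 0 < t \<Longrightarrow> 0 \<le> h z t"
    and density: "\<And>t. 0 < t \<Longrightarrow> distributed M lborel (A t) (\<lambda>z. ennreal (h z t))"
  shows "stable_density \<nu> h"
proof
  interpret A: stable_subordinator M A "1 / \<nu>" by (fact A)
  show "1 < \<nu>" by (fact nu)
  show "0 \<le> h z t" if "0 < t" for z t using nonneg that .
  show meas: "(\<lambda>z. h z t) \<in> borel_measurable borel" if t: "0 < t" for t
    using distributed_real_measurable[OF _ density[OF t]] nonneg[OF t] by simp
  show "has_bochner_integral lborel (\<lambda>z. indicator {0<..} z *\<^sub>R (exp (- k * z) * h z t))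
      (exp (- (k powr (1 / \<nu>)) * t))" if k: "1 \<le> k" and t: "0 < t" for k t
  proof -
    have pos: "0 \<le> A t \<omega>" if "\<omega> \<in> space M" for \<omega>
      using mono_onD[OF A.mono_path[OF that], of 0 t] A.start[OF that] t by simp
    have "integrable M (\<lambda>\<omega>. exp (- k * A t \<omega>))"
      using A.rv[of t] t k pos by (intro A.integrable_const_bound[where B = 1]) auto
    then have "integrable lborel (\<lambda>z. h z t * exp (- k * z))"
      using distributed_integrable[OF density[OF t], of "\<lambda>z. exp (- k * z)"] nonneg[OF t] by simp
    moreover have "(\<integral>z. h z t * exp (- k * z) \<partial>lborel) = exp (- (k powr (1 / \<nu>)) * t)"
      using distributed_integral[OF density[OF t], of "\<lambda>z. exp (- k * z)"] nonneg[OF t]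
        A.laplace[of k t] k t by simp
    ultimately have int: "has_bochner_integral lborel (\<lambda>z. h z t * exp (- k * z))
        (exp (- (k powr (1 / \<nu>)) * t))"
      by (simp add: has_bochner_integral_iff)
    have "emeasure M (A t -` {..<0} \<inter> space M) = (\<integral>\<^sup>+z. ennreal (h z t) * indicator {..<0} z \<partial>lborel)"
      by (rule distributed_emeasure[OF density[OF t]]) simp
    moreover have "A t -` {..<0} \<inter> space M = {}" using pos by force
    ultimately have "(\<integral>\<^sup>+z. ennreal (h z t) * indicator {..<0} z \<partial>lborel) = 0" by simp
    then have "AE z in lborel. ennreal (h z t) * indicator {..<0} z = 0"
      using meas[OF t] by (subst (asm) nn_integral_0_iff_AE) auto
    moreover have "AE z in lborel. z \<noteq> (0::real)" by (rule AE_lborel_singleton)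
    ultimately have "AE z in lborel. h z t * exp (- k * z)
        = indicator {0<..} z *\<^sub>R (exp (- k * z) * h z t)"
    proof eventually_elim
      case (elim z)
      then show ?case using nonneg[OF t, of z]
        by (cases "0 < z") (auto simp: indicator_def mult.commute)
    qed
    then show ?thesis
      using int meas[OF t]
      by (subst has_bochner_integral_cong_AE[where g = "\<lambda>z. h z t * exp (- k * z)"]) auto
  qed
qed

theorem theorem6:
  fixes M :: "'a measure"
    and G A :: "real \<Rightarrow> 'a \<Rightarrow> real"
    and h f :: "real \<Rightarrow> real \<Rightarrow> real"
    and b \<nu> :: real
  assumes b: "b > 0" and nu: "\<nu> > 1"
    and G: "gamma_subordinator M G b"
    and A: "stable_subordinator M A (1 / \<nu>)"
    and indep: "indep_processes M G A"
    and h_nonneg: "\<And>z t. t > 0 \<Longrightarrow> h z t \<ge> 0"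
    and h_density: "\<And>t. t > 0 \<Longrightarrow> distributed M lborel (A t) (\<lambda>z. ennreal (h z t))"
    and f_density: "\<And>t. t > 0 \<Longrightarrow>
          distributed M lborel (\<lambda>\<omega>. G (A t \<omega>) \<omega>) (\<lambda>x. ennreal (f x t))"
    and f_formula: "\<And>x t. x \<ge> 0 \<Longrightarrow> t > 0 \<Longrightarrow>
          f x t = (LBINT z:{0<..}. gamma_density b x z * h z t)"
  shows "\<forall>t>1.
     (\<forall>x>0. frac_shift_defined \<nu> (- 1) (\<lambda>s. f x s) t \<and>
        ((\<lambda>y. f y t) has_real_derivative
           - b * (f x t - frac_shift \<nu> (- 1) (\<lambda>s. f x s) t)) (at x)) \<and>
     f 0 t = 0"
proof (intro allI impI conjI)
  interpret stable_density \<nu> h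
    by (rule stable_density_of_subordinator[OF nu A h_nonneg h_density])
  fix t :: real assume "1 < t"
  then have t: "0 < t" by simp
  have f: "f x s = mix (gamma_kernel b x) s" if "0 < x" "0 < s" for x s
    using that f_formula[of x s] by (simp add: mix_def gamma_density_eq_gamma_kernel[OF b])
  show "f 0 t = 0"
    using f_formula[of 0 t] t by (simp add: gamma_density_def)
  fix x :: real assume x: "0 < x"
  obtain g C where g:
    "\<And>n z. (g n has_real_derivative - g (Suc n) z) (at z)"
    "\<And>n z. 0 \<le> z \<Longrightarrow> \<bar>g n z\<bar> \<le> C * fact n / 2 ^ n * exp (- 2 * z)"
    "\<And>z. (\<lambda>n. g n z / fact n) sums gamma_kernel b x (z - 1)"
    "g 0 = gamma_kernel b x"
    using gamma_kernel_time_derivatives[OF b x] by blast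
  have cont: "continuous_on {0..} (g n)" for n
    using DERIV_isCont[OF g(1)] by (auto intro: continuous_at_imp_continuous_on)
  have fx: "f x s = mix (g 0) s" if "0 < s" for s
    using f[OF x that] g(4) by simp
  note shift = frac_shift_mix[where g = g, OF g(1) cont g(2,3)
      continuous_gamma_kernel[OF b x] fx t]
  show "frac_shift_defined \<nu> (- 1) (\<lambda>s. f x s) t" by (rule shift(1))
  have "b * (mix (\<lambda>z. gamma_kernel b x (z - 1)) t - mix (gamma_kernel b x) t)
      = - b * (f x t - frac_shift \<nu> (- 1) (\<lambda>s. f x s) t)"
    by (simp add: shift(2) f[OF x t] algebra_simps)
  then have "((\<lambda>y. mix (gamma_kernel b y) t) has_real_derivative
      - b * (f x t - frac_shift \<nu> (- 1) (\<lambda>s. f x s) t)) (at x)"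
    using has_derivative_mix_gamma_kernel[OF b x t] by simp
  then show "((\<lambda>y. f y t) has_real_derivative
      - b * (f x t - frac_shift \<nu> (- 1) (\<lambda>s. f x s) t)) (at x)"
    by (rule has_field_derivative_transform_within_open[of _ _ _ "{0<..}"])
       (use x f t in auto)
qed

end
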